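(* Let $n\ge2$, $n'=\frac n{n-1}$, and let $\Omega\subset\mathbb{R}^n$ be a bounded open set with $|\Omega|=1$. For $0<\theta<1$, $$(L^{n'}(\Omega),L^{(n'}(\Omega))_{\theta,1}=L^{(n',\theta}(\Omega),$$ with equivalent norms.
   Context: $\log$ is the natural logarithm. For measurable $f:\Omega\to\mathbb{R}$, $f_*$ is the decreasing rearrangement of $|f|$ on $(0,1)$: $f_*(s)=\inf\{t\ge0:|\{x:|f(x)|>t\}|\le s\}$, and $f_*^p=(f_* )^p$. Small Lebesgue space $L^{(p,\theta}(\Omega)$ ($1<p<\infty$, $\theta>0$): measurable $f$ with $\|f\|_{(p,\theta}=\int_0^1(1-\log t)^{-\frac\theta p+\theta-1}\left(\int_0^t f_*^p(\sigma)\,d\sigma\right)^{1/p}\frac{dt}{t}<\infty$. $L^{(p}=L^{(p,1}$. For a compatible couple $(X_0,X_1)$, $K(f,t;X_0,X_1)=\inf_{f=f_0+f_1}(\|f_0\|_{X_0}+t\|f_1\|_{X_1})$, and $(X_0,X_1)_{\theta,1}$ is the set of $f\in X_0+X_1$ with $\|f\|_{(X_0,X_1)_{\theta,1}}=\int_0^1 t^{-\theta}K(f,t;X_0,X_1)\frac{dt}{t}<\infty$. Equality of spaces means equality as sets with equivalent norms. *)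

theory Defs
  imports "HOL-Analysis.Analysis"
begin

text \<open>
  A function space over \<open>M\<close> is a pair of its carrier and its extended norm. Elements of the
  spaces are represented by measurable functions and identified up to equality almost everywhere:
  all norms below are invariant under changes on null sets, and sums are taken a.e. The ambient
  space that makes any two spaces a compatible couple is that of all (a.e. classes of)
  measurable real functions.
\<close>

type_synonym 'a fspace = "('a \<Rightarrow> real) set \<times> (('a \<Rightarrow> real) \<Rightarrow> ennreal)"

definition carr :: "'a fspace \<Rightarrow> ('a \<Rightarrow> real) set" where
  "carr X = fst X"

definition fnorm :: "'a fspace \<Rightarrow> ('a \<Rightarrow> real) \<Rightarrow> ennreal" where
  "fnorm X = snd X"

definition fspace_of_norm :: "'a measure \<Rightarrow> (('a \<Rightarrow> real) \<Rightarrow> ennreal) \<Rightarrow> 'a fspace" where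
  "fspace_of_norm M N = ({f \<in> borel_measurable M. N f < \<infinity>}, N)"

definition equal_equiv_norms :: "'a fspace \<Rightarrow> 'a fspace \<Rightarrow> bool" where
  "equal_equiv_norms X Y \<longleftrightarrow>
     carr X = carr Y \<and>
     (\<exists>c>0. \<exists>C>0. \<forall>f\<in>carr X.
        ennreal c * fnorm X f \<le> fnorm Y f \<and> fnorm Y f \<le> ennreal C * fnorm X f)"

text \<open>Powers with a positive real exponent, with \<open>\<infinity>\<^sup>a = \<infinity>\<close>.\<close>

definition ennpowr :: "ennreal \<Rightarrow> real \<Rightarrow> ennreal" where
  "ennpowr x a = (if x = \<infinity> then \<infinity> else ennreal (enn2real x powr a))"

definition Lp :: "'a measure \<Rightarrow> real \<Rightarrow> 'a fspace" where
  "Lp M p = fspace_of_norm M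
     (\<lambda>f. ennpowr (\<integral>\<^sup>+x. ennreal (\<bar>f x\<bar> powr p) \<partial>M) (1 / p))"

text \<open>
  On a finite measure space and for \<open>s > 0\<close>, which are the only cases in use, the infimum is
  over a nonempty set, so the real-valued \<open>Inf\<close> is the intended one.
\<close>

definition decr_rearr :: "'a measure \<Rightarrow> ('a \<Rightarrow> real) \<Rightarrow> real \<Rightarrow> real" where
  "decr_rearr M f s = Inf {t. 0 \<le> t \<and> emeasure M {x \<in> space M. \<bar>f x\<bar> > t} \<le> ennreal s}"

definition small_Lebesgue :: "'a measure \<Rightarrow> real \<Rightarrow> real \<Rightarrow> 'a fspace" where
  "small_Lebesgue M p \<theta> = fspace_of_norm M
     (\<lambda>f. \<integral>\<^sup>+t\<in>{0<..<1}.
        ennreal ((1 - ln t) powr (- \<theta> / p + \<theta> - 1) / t) *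
        ennpowr (\<integral>\<^sup>+\<sigma>\<in>{0<..<t}. ennreal (decr_rearr M f \<sigma> powr p) \<partial>lborel) (1 / p)
      \<partial>lborel)"

definition decompositions ::
    "'a measure \<Rightarrow> 'a fspace \<Rightarrow> 'a fspace \<Rightarrow> ('a \<Rightarrow> real) \<Rightarrow> (('a \<Rightarrow> real) \<times> ('a \<Rightarrow> real)) set" where
  "decompositions M X0 X1 f =
     {(f0, f1). f0 \<in> carr X0 \<and> f1 \<in> carr X1 \<and> (AE x in M. f x = f0 x + f1 x)}"

definition sum_carr :: "'a measure \<Rightarrow> 'a fspace \<Rightarrow> 'a fspace \<Rightarrow> ('a \<Rightarrow> real) set" where
  "sum_carr M X0 X1 = {f \<in> borel_measurable M. decompositions M X0 X1 f \<noteq> {}}"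

definition K_functional ::
    "'a measure \<Rightarrow> 'a fspace \<Rightarrow> 'a fspace \<Rightarrow> ('a \<Rightarrow> real) \<Rightarrow> real \<Rightarrow> ennreal" where
  "K_functional M X0 X1 f t =
     (INF (f0, f1) \<in> decompositions M X0 X1 f. fnorm X0 f0 + ennreal t * fnorm X1 f1)"

definition interp_norm ::
    "'a measure \<Rightarrow> 'a fspace \<Rightarrow> 'a fspace \<Rightarrow> real \<Rightarrow> ('a \<Rightarrow> real) \<Rightarrow> ennreal" where
  "interp_norm M X0 X1 \<theta> f =
     (\<integral>\<^sup>+t\<in>{0<..<1}. ennreal (t powr (- \<theta>) / t) * K_functional M X0 X1 f t \<partial>lborel)"

text \<open>The space \<open>(X\<^sub>0, X\<^sub>1)\<close> with parameters \<open>\<theta>, 1\<close>; the integral is over \<open>(0,1)\<close>, not \<open>(0,\<infinity>)\<close>.\<close>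

definition interp_space_1 :: "'a measure \<Rightarrow> 'a fspace \<Rightarrow> 'a fspace \<Rightarrow> real \<Rightarrow> 'a fspace" where
  "interp_space_1 M X0 X1 \<theta> =
     ({f \<in> sum_carr M X0 X1. interp_norm M X0 X1 \<theta> f < \<infinity>}, interp_norm M X0 X1 \<theta>)"

end

theory Submission
  imports Defs "HOL-Probability.Probability_Measure"
begin

text \<open>
  Let \<open>M\<close> be a probability space, \<open>p > 1\<close>, \<open>q = 1 - 1 / p\<close>, and let
  \<open>F\<^sub>f(s)\<close> be the \<open>L\<^sup>p\<close> norm of \<open>f\<^sub>*\<close> on \<open>(0, s)\<close>, written \<open>head_norm M p f s\<close> below. The
  variable \<open>t = (1 - ln s) powr (- q)\<close>, which increases from 0 to 1 with \<open>s\<close>, turns the norm of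
  every small Lebesgue space into a power-weighted integral: with \<open>G(u) = F\<^sub>f(s)\<close> for
  \<open>u = 1 / t\<close>, the norm of index \<open>\<theta>\<close> is a multiple of the integral of
  \<open>u powr (\<theta> - 1) * G(u)\<close> over \<open>u > 1\<close>. In particular the norm of index 1 is a multiple of the
  unweighted integral of \<open>G\<close>, while the \<open>L\<^sup>p\<close> norm is \<open>G(1)\<close>. The interpolation norm, in
  turn, integrates \<open>u powr (\<theta> - 1) * K(f, 1 / u)\<close>, and so everything reduces to two estimates of the
  K-functional.

  From below, \<open>G(u) \<le> C K(f, 1 / u)\<close>. Indeed \<open>F\<close> satisfies a quasi-triangle inequality
  (\<open>head_norm_add_le\<close>), and for the two parts of a decomposition \<open>f = f\<^sub>0 + f\<^sub>1\<close> one has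
  \<open>F\<close> of \<open>f\<^sub>0\<close> at most the \<open>L\<^sup>p\<close> norm, because \<open>F\<close> is increasing in \<open>s\<close>, and \<open>F\<close> of \<open>f\<^sub>1\<close>
  at most \<open>C / u\<close> times the norm of index 1, because \<open>G\<close> is decreasing in \<open>u\<close>
  (\<open>head_norm_le_small_Lebesgue\<close>).

  From above, truncating \<open>f\<close> at height \<open>f\<^sub>*(s)\<close> gives
  \<open>K(f, 1 / u) \<le> (1 + p) G(u) + C / u * (integral of G over (1, u))\<close> (\<open>K_functional_le\<close>):
  the excess over the truncation has \<open>L\<^sup>p\<close> norm at most \<open>F\<^sub>f(s)\<close>, and the contribution
  to the norm of the bounded part from \<open>(0, s)\<close> is controlled by \<open>F\<^sub>f(s)\<close> because
  \<open>\<tau> powr (1 / p - 1)\<close> is integrable at 0. Multiplying by the weight and integrating, the first term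
  is the norm of index \<open>\<theta>\<close> after the change of variable, and the second is Hardy's inequality, that
  is, Fubini together with \<open>\<theta> < 1\<close> (\<open>nn_integral_log_Hardy\<close>).

  The normalization of the total mass to 1 is what makes the \<open>L\<^sup>p\<close> norm equal to \<open>F\<^sub>f(1)\<close>.
\<close>

section \<open>Powers of extended nonnegative reals\<close>

lemma ennpowr_mono: "x \<le> y \<Longrightarrow> 0 \<le> a \<Longrightarrow> ennpowr x a \<le> ennpowr y a"
  unfolding ennpowr_def
  by (auto simp: top_unique less_top intro!: ennreal_leI powr_mono2 enn2real_mono)

lemma ennpowr_ennreal: "0 \<le> x \<Longrightarrow> ennpowr (ennreal x) a = ennreal (x powr a)"
  by (simp add: ennpowr_def)

lemma ennpowr_cmult:
  assumes "0 < c" shows "ennpowr (ennreal c * x) a = ennreal (c powr a) * ennpowr x a"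
proof (cases x)
  case (real r)
  then show ?thesis using assms
    by (simp add: ennpowr_ennreal ennreal_mult[symmetric] powr_mult)
next
  case top
  then show ?thesis using assms by (simp add: ennpowr_def ennreal_mult_top)
qed

lemma ennpowr_add_le:
  assumes "0 \<le> a" shows "ennpowr (x + y) a \<le> ennreal (2 powr a) * (ennpowr x a + ennpowr y a)"
proof -
  have "x + y \<le> ennreal 2 * max x y"
    using add_mono[of x "max x y" y "max x y"] by (simp add: mult_2)
  then have "ennpowr (x + y) a \<le> ennreal (2 powr a) * ennpowr (max x y) a"
    using ennpowr_mono[of _ "ennreal 2 * max x y", OF _ assms] ennpowr_cmult[of 2 "max x y" a] by simp
  also have "ennpowr (max x y) a \<le> ennpowr x a + ennpowr y a"
    by (auto simp: max_def)
  finally show ?thesis by (simp add: mult_left_mono)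
qed

section \<open>The decreasing rearrangement\<close>

lemma bdd_below_levels: "bdd_below {t. 0 \<le> t \<and> emeasure M {x \<in> space M. \<bar>f x\<bar> > t} \<le> ennreal s}"
  by (auto intro: bdd_belowI[of _ 0])

lemma decr_rearr_le:
  "0 \<le> t \<Longrightarrow> emeasure M {x \<in> space M. \<bar>f x\<bar> > t} \<le> ennreal s \<Longrightarrow> decr_rearr M f s \<le> t"
  unfolding decr_rearr_def by (rule cInf_lower[OF _ bdd_below_levels]) simp

context finite_measure
begin

lemma ex_level_le:
  fixes f :: "'a \<Rightarrow> real"
  assumes f[measurable]: "f \<in> borel_measurable M" and s: "(0::real) < s"
  shows "\<exists>t\<ge>0. emeasure M {x \<in> space M. \<bar>f x\<bar> > t} \<le> ennreal s"
proof -
  let ?A = "\<lambda>k::nat. {x \<in> space M. \<bar>f x\<bar> > real k}"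
  have "(\<lambda>k. emeasure M (?A k)) \<longlonglongrightarrow> emeasure M (\<Inter>k. ?A k)"
    by (rule Lim_emeasure_decseq) (auto simp: decseq_def)
  moreover have "(\<Inter>k. ?A k) = {}"
  proof -
    have "\<exists>k::nat. \<not> \<bar>f x\<bar> > real k" for x
      using real_arch_simple[of "\<bar>f x\<bar>"] by (auto simp: not_less)
    then show ?thesis by fast
  qed
  ultimately have "(\<lambda>k. emeasure M (?A k)) \<longlonglongrightarrow> 0" by simp
  then have "eventually (\<lambda>k. emeasure M (?A k) < ennreal s) sequentially"
    by (rule order_tendstoD) (use s in simp)
  then obtain k where "emeasure M (?A k) < ennreal s"
    by (auto simp: eventually_sequentially)
  then show ?thesis by (intro exI[of _ "real k"]) auto
qed

lemma decr_rearr_nonneg: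
  assumes "f \<in> borel_measurable M" "0 < s" shows "0 \<le> decr_rearr M f s"
  unfolding decr_rearr_def using ex_level_le[OF assms] by (intro cInf_greatest) auto

text \<open>
  The superlevel sets increase to the one at the infimum as the level decreases to it, so the
  infimum that defines the rearrangement is attained.
\<close>

lemma emeasure_level_decr_rearr:
  fixes f :: "'a \<Rightarrow> real"
  assumes f[measurable]: "f \<in> borel_measurable M" and s: "0 < s"
  shows "emeasure M {x \<in> space M. \<bar>f x\<bar> > decr_rearr M f s} \<le> ennreal s"
proof -
  define a where "a = decr_rearr M f s"
  let ?A = "\<lambda>k::nat. {x \<in> space M. \<bar>f x\<bar> > a + inverse (real (Suc k))}"
  have *: "emeasure M (?A k) \<le> ennreal s" for k
  proof -
    have "a < a + inverse (real (Suc k))" by simp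
    then obtain t where t: "0 \<le> t" "emeasure M {x \<in> space M. \<bar>f x\<bar> > t} \<le> ennreal s"
      "t < a + inverse (real (Suc k))"
      unfolding a_def decr_rearr_def using ex_level_le[OF assms]
      by (subst (asm) cInf_less_iff[OF _ bdd_below_levels]) auto
    have "emeasure M (?A k) \<le> emeasure M {x \<in> space M. \<bar>f x\<bar> > t}"
      by (rule emeasure_mono) (use t in auto)
    then show ?thesis using t by simp
  qed
  have "incseq ?A"
  proof (rule incseq_SucI, safe)
    fix k x assume "a + inverse (real (Suc k)) < \<bar>f x\<bar>"
    moreover have "inverse (real (Suc (Suc k))) \<le> inverse (real (Suc k))"
      by (intro le_imp_inverse_le) auto
    ultimately show "a + inverse (real (Suc (Suc k))) < \<bar>f x\<bar>" by linarith
  qed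
  then have "emeasure M (\<Union>k. ?A k) = (SUP k. emeasure M (?A k))"
    by (intro SUP_emeasure_incseq[symmetric]) auto
  also have "\<dots> \<le> ennreal s" using * by (intro SUP_least)
  also have "(\<Union>k. ?A k) = {x \<in> space M. \<bar>f x\<bar> > a}"
  proof safe
    fix x assume "x \<in> space M" "a < \<bar>f x\<bar>"
    then have "0 < \<bar>f x\<bar> - a" by simp
    from reals_Archimedean[OF this] obtain k where "inverse (real (Suc k)) < \<bar>f x\<bar> - a" by auto
    then show "x \<in> (\<Union>k. ?A k)" using \<open>x \<in> space M\<close> by (auto simp: algebra_simps)
  next
    fix x k assume "a + inverse (real (Suc k)) < \<bar>f x\<bar>"
    moreover have "0 < inverse (real (Suc k))" by simp
    ultimately show "a < \<bar>f x\<bar>" by linarith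
  qed
  finally show ?thesis by (simp add: a_def)
qed

text \<open>
  The generalized-inverse relation between \<open>f\<^sub>*\<close> and the distribution function. It makes the
  superlevel sets of \<open>f\<^sub>*\<close> explicit intervals.
\<close>

lemma less_decr_rearr_iff:
  assumes "f \<in> borel_measurable M" "0 < s" "0 \<le> t"
  shows "t < decr_rearr M f s \<longleftrightarrow> ennreal s < emeasure M {x \<in> space M. \<bar>f x\<bar> > t}"
proof
  assume "t < decr_rearr M f s"
  then show "ennreal s < emeasure M {x \<in> space M. \<bar>f x\<bar> > t}"
    using decr_rearr_le[of t M f s] assms by (meson not_le)
next
  assume L: "ennreal s < emeasure M {x \<in> space M. \<bar>f x\<bar> > t}"
  show "t < decr_rearr M f s"
  proof (rule ccontr)
    assume "\<not> t < decr_rearr M f s"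
    then have "emeasure M {x \<in> space M. \<bar>f x\<bar> > t} \<le> emeasure M {x \<in> space M. \<bar>f x\<bar> > decr_rearr M f s}"
      using assms(1) by (intro emeasure_mono) auto
    with emeasure_level_decr_rearr[OF assms(1,2)] L show False by auto
  qed
qed

lemma decr_rearr_antimono:
  assumes "f \<in> borel_measurable M" "0 < s" "s \<le> s'"
  shows "decr_rearr M f s' \<le> decr_rearr M f s"
  using assms
  by (intro decr_rearr_le decr_rearr_nonneg order.trans[OF emeasure_level_decr_rearr] ennreal_leI)

lemma decr_rearr_mono_fun:
  assumes "f \<in> borel_measurable M" "g \<in> borel_measurable M" "\<And>x. x \<in> space M \<Longrightarrow> \<bar>f x\<bar> \<le> \<bar>g x\<bar>" "0 < s"
  shows "decr_rearr M f s \<le> decr_rearr M g s"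
proof (rule decr_rearr_le)
  show "0 \<le> decr_rearr M g s" using assms by (intro decr_rearr_nonneg)
  have "emeasure M {x \<in> space M. decr_rearr M g s < \<bar>f x\<bar>} \<le> emeasure M {x \<in> space M. decr_rearr M g s < \<bar>g x\<bar>}"
    using assms by (intro emeasure_mono) (force, measurable)
  also have "\<dots> \<le> ennreal s" using assms by (intro emeasure_level_decr_rearr)
  finally show "emeasure M {x \<in> space M. decr_rearr M g s < \<bar>f x\<bar>} \<le> ennreal s" .
qed

lemma decr_rearr_le_bound:
  assumes "\<And>x. x \<in> space M \<Longrightarrow> \<bar>f x\<bar> \<le> c" "0 \<le> c"
  shows "decr_rearr M f s \<le> c"
proof (rule decr_rearr_le)
  have "{x \<in> space M. c < \<bar>f x\<bar>} = {}" using assms by force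
  then show "emeasure M {x \<in> space M. c < \<bar>f x\<bar>} \<le> ennreal s" by (metis emeasure_empty zero_le)
qed fact

text \<open>
  If \<open>\<bar>f\<bar> > a + b\<close>, then \<open>\<bar>f0\<bar> > a\<close> or \<open>\<bar>f1\<bar> > b\<close>; each of these events is given half of the
  measure \<open>s\<close>.
\<close>

lemma decr_rearr_add_le:
  assumes [measurable]: "f \<in> borel_measurable M" "f0 \<in> borel_measurable M" "f1 \<in> borel_measurable M"
    and ae: "AE x in M. f x = f0 x + f1 x" and s: "0 < s"
  shows "decr_rearr M f s \<le> decr_rearr M f0 (s / 2) + decr_rearr M f1 (s / 2)"
proof (rule decr_rearr_le)
  let ?a = "decr_rearr M f0 (s / 2)" and ?b = "decr_rearr M f1 (s / 2)"
  show "0 \<le> ?a + ?b" using assms by (intro add_nonneg_nonneg decr_rearr_nonneg) auto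
  have "emeasure M {x \<in> space M. ?a + ?b < \<bar>f x\<bar>}
      \<le> emeasure M ({x \<in> space M. ?a < \<bar>f0 x\<bar>} \<union> {x \<in> space M. ?b < \<bar>f1 x\<bar>})"
    by (rule emeasure_mono_AE) (use ae in \<open>eventually_elim, auto\<close>)
  also have "\<dots> \<le> emeasure M {x \<in> space M. ?a < \<bar>f0 x\<bar>} + emeasure M {x \<in> space M. ?b < \<bar>f1 x\<bar>}"
    by (rule emeasure_subadditive) auto
  also have "\<dots> \<le> ennreal (s/2) + ennreal (s/2)"
    using s by (intro add_mono emeasure_level_decr_rearr) auto
  also have "\<dots> = ennreal s" using s by (simp flip: ennreal_plus)
  finally show "emeasure M {x \<in> space M. ?a + ?b < \<bar>f x\<bar>} \<le> ennreal s" .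
qed

lemma decr_rearr_measurable:
  assumes "f \<in> borel_measurable M" "A \<in> sets borel" "A \<subseteq> {0<..}"
  shows "decr_rearr M f \<in> borel_measurable (restrict_space lborel A)"
proof -
  have "mono_on A (\<lambda>s. - decr_rearr M f s)"
    using assms decr_rearr_antimono[OF assms(1)] by (force simp: mono_on_def)
  then have "(\<lambda>s. - decr_rearr M f s) \<in> borel_measurable (restrict_space borel A)"
    by (rule borel_measurable_mono_on_fnc)
  then have "(\<lambda>s. - (- decr_rearr M f s)) \<in> borel_measurable (restrict_space borel A)"
    by (rule borel_measurable_uminus)
  then show ?thesis
    by (simp cong: measurable_cong_sets sets_restrict_space_cong)
qed

end

text \<open>
  Equimeasurability. By \<open>less_decr_rearr_iff\<close>, the set of \<open>s\<close> in \<open>(0, 1)\<close> with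
  \<open>x < f\<^sub>*(s)\<close> is, for \<open>x \<ge> 0\<close>, the interval from 0 to the mass of \<open>x < \<bar>f\<bar>\<close>; for \<open>x < 0\<close> both half-lines
  have the total mass 1. So the two distributions agree on all half-lines.
\<close>

lemma (in prob_space) distr_decr_rearr:
  assumes f[measurable]: "f \<in> borel_measurable M"
  shows "distr (restrict_space lborel {0<..<1}) borel (decr_rearr M f) = distr M borel (\<lambda>x. \<bar>f x\<bar>)"
    (is "?L = ?R")
proof -
  let ?U = "restrict_space lborel {0<..<1::real}"
  have m[measurable]: "decr_rearr M f \<in> borel_measurable ?U"
    by (rule decr_rearr_measurable) auto
  have sp: "space ?U = {0<..<1}" by (simp add: space_restrict_space)
  have sU: "emeasure ?U A = emeasure lborel A" if "A \<subseteq> {0<..<1}" for A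
    by (rule emeasure_restrict_space) (use that in auto)
  have L: "emeasure ?L {x<..} = emeasure lborel {s \<in> {0<..<1}. x < decr_rearr M f s}" for x
  proof -
    have "emeasure ?L {x<..} = emeasure ?U {s \<in> {0<..<1}. x < decr_rearr M f s}"
      by (subst emeasure_distr) (auto simp: sp vimage_def Int_def conj_commute intro!: arg_cong[of _ _ "emeasure ?U"])
    then show ?thesis by (subst (asm) sU) auto
  qed
  have R: "emeasure ?R {x<..} = emeasure M {y \<in> space M. x < \<bar>f y\<bar>}" for x
    by (subst emeasure_distr) (auto simp: vimage_def Int_def conj_commute intro!: arg_cong[of _ _ "emeasure M"])
  have eq: "emeasure ?L {x<..} = emeasure ?R {x<..}" for x
  proof (cases "x < 0")
    case True
    have "{s \<in> {0<..<1}. x < decr_rearr M f s} = {0<..<1}"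
      using True decr_rearr_nonneg[OF f] by force
    moreover have "{y \<in> space M. x < \<bar>f y\<bar>} = space M" using True by auto
    ultimately show ?thesis by (simp add: L R emeasure_space_1)
  next
    case False
    define m where "m = measure M {y \<in> space M. x < \<bar>f y\<bar>}"
    have m: "emeasure M {y \<in> space M. x < \<bar>f y\<bar>} = ennreal m" "0 \<le> m" "m \<le> 1"
      by (auto simp: m_def emeasure_eq_measure)
    have "{s \<in> {0<..<1}. x < decr_rearr M f s} = {0<..<m}"
      using False m less_decr_rearr_iff[OF f, of _ x] by (auto simp: ennreal_less_iff)
    then show ?thesis using m by (simp add: L R)
  qed
  show ?thesis
  proof (rule measure_eqI_lessThan)
    fix x :: real
    have "emeasure ?R {x<..} < \<infinity>" by (simp add: R less_top[symmetric])
    then show "emeasure ?L {x<..} < \<infinity>" by (simp add: eq)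
  qed (auto simp: eq)
qed

lemma (in prob_space) nn_integral_decr_rearr:
  assumes f[measurable]: "f \<in> borel_measurable M" and h[measurable]: "h \<in> borel_measurable borel"
  shows "(\<integral>\<^sup>+s\<in>{0<..<1}. h (decr_rearr M f s) \<partial>lborel) = (\<integral>\<^sup>+x. h \<bar>f x\<bar> \<partial>M)"
proof -
  have m[measurable]: "decr_rearr M f \<in> borel_measurable (restrict_space lborel {0<..<1})"
    by (rule decr_rearr_measurable) auto
  have "(\<integral>\<^sup>+s\<in>{0<..<1}. h (decr_rearr M f s) \<partial>lborel) = (\<integral>\<^sup>+s. h (decr_rearr M f s) \<partial>restrict_space lborel {0<..<1})"
    by (rule nn_integral_restrict_space[symmetric]) auto
  also have "\<dots> = integral\<^sup>N (distr (restrict_space lborel {0<..<1}) borel (decr_rearr M f)) h"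
    by (subst nn_integral_distr) auto
  also have "\<dots> = (\<integral>\<^sup>+x. h \<bar>f x\<bar> \<partial>M)"
    unfolding distr_decr_rearr[OF f] by (subst nn_integral_distr) auto
  finally show ?thesis .
qed

section \<open>The norm of the largest values of a function\<close>

lemma borel_measurable_mono_ennreal:
  fixes h :: "real \<Rightarrow> ennreal"
  assumes "mono h" shows "h \<in> borel_measurable borel"
proof (rule borel_measurableI_greater)
  fix y
  have "is_interval {x. y < h x}"
    using assms by (auto simp: is_interval_1 mono_def intro: less_le_trans)
  then show "{x \<in> space borel. y < h x} \<in> sets borel"
    using real_interval_borel_measurable by simp
qed

text \<open>
  For a nonatomic measure this is the largest \<open>L\<^sup>p\<close> norm of \<open>f\<close> over a set of measure \<open>t\<close>.
  It is the quantity whose weighted integrals define the small Lebesgue norms.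
\<close>

definition head_norm :: "'a measure \<Rightarrow> real \<Rightarrow> ('a \<Rightarrow> real) \<Rightarrow> real \<Rightarrow> ennreal" where
  "head_norm M p f t = ennpowr (\<integral>\<^sup>+\<sigma>\<in>{0<..<t}. ennreal (decr_rearr M f \<sigma> powr p) \<partial>lborel) (1 / p)"

lemma mono_head_norm: "0 \<le> p \<Longrightarrow> mono (head_norm M p f)"
  unfolding head_norm_def
  by (intro monoI ennpowr_mono nn_integral_mono) (auto simp: indicator_def)

lemma head_norm_mono: "0 \<le> p \<Longrightarrow> s \<le> t \<Longrightarrow> head_norm M p f s \<le> head_norm M p f t"
  using mono_head_norm[of p M f] by (auto dest: monoD)

lemma measurable_head_norm: "0 \<le> p \<Longrightarrow> head_norm M p f \<in> borel_measurable borel"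
  by (intro borel_measurable_mono_ennreal mono_head_norm)

lemma fnorm_small_Lebesgue:
  "fnorm (small_Lebesgue M p \<theta>) f =
     (\<integral>\<^sup>+t\<in>{0<..<1}. ennreal ((1 - ln t) powr (- \<theta> / p + \<theta> - 1) / t) * head_norm M p f t \<partial>lborel)"
  by (simp add: fnorm_def small_Lebesgue_def fspace_of_norm_def head_norm_def)

lemma carr_small_Lebesgue:
  "carr (small_Lebesgue M p \<theta>) = {f \<in> borel_measurable M. fnorm (small_Lebesgue M p \<theta>) f < \<infinity>}"
  by (simp add: carr_def fnorm_def small_Lebesgue_def fspace_of_norm_def)

lemma carr_Lp: "carr (Lp M p) = {f \<in> borel_measurable M. fnorm (Lp M p) f < \<infinity>}"
  by (simp add: carr_def fnorm_def Lp_def fspace_of_norm_def)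

lemma fnorm_Lp: "fnorm (Lp M p) f = ennpowr (\<integral>\<^sup>+x. ennreal (\<bar>f x\<bar> powr p) \<partial>M) (1 / p)"
  by (simp add: fnorm_def Lp_def fspace_of_norm_def)

lemma (in finite_measure) measurable_decr_rearr_indicator:
  fixes h :: "real \<Rightarrow> ennreal"
  assumes "f \<in> borel_measurable M" and h[measurable]: "h \<in> borel_measurable borel"
  shows "(\<lambda>\<sigma>. h (decr_rearr M f \<sigma>) * indicator {0<..<t} \<sigma>) \<in> borel_measurable borel"
proof -
  have [measurable]: "decr_rearr M f \<in> borel_measurable (restrict_space lborel {0<..<t})"
    by (rule decr_rearr_measurable) (use assms in auto)
  have "(\<lambda>\<sigma>. h (decr_rearr M f \<sigma>)) \<in> borel_measurable (restrict_space lborel {0<..<t})"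
    by measurable
  then show ?thesis
    by (subst (asm) borel_measurable_restrict_space_iff_ennreal) auto
qed

lemma (in finite_measure) nn_integral_decr_rearr_half:
  fixes h :: "real \<Rightarrow> ennreal"
  assumes "f \<in> borel_measurable M" and h[measurable]: "h \<in> borel_measurable borel"
  shows "(\<integral>\<^sup>+\<sigma>\<in>{0<..<s}. h (decr_rearr M f (\<sigma> / 2)) \<partial>lborel)
       = 2 * (\<integral>\<^sup>+\<sigma>\<in>{0<..<s / 2}. h (decr_rearr M f \<sigma>) \<partial>lborel)"
proof -
  note [measurable] = measurable_decr_rearr_indicator[OF assms]
  have i: "indicator {0<..<s / 2} (\<sigma> / 2) = (indicator {0<..<s} \<sigma> :: ennreal)" for \<sigma>
    by (auto simp: indicator_def)
  have "(\<lambda>\<sigma>. h (decr_rearr M f (\<sigma> / 2)) * indicator {0<..<s/2} (\<sigma> / 2)) \<in> borel_measurable borel"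
    by (rule measurable_compose[OF _ measurable_decr_rearr_indicator[OF assms]]) simp
  from nn_integral_real_affine[OF this, of 2 0] show ?thesis
    by (simp add: i)
qed

text \<open>
  Since \<open>f\<^sub>*\<close> is decreasing, the first half of \<open>(0, s)\<close> carries at least half of the integral.
  This doubling property keeps the estimates uniform up to the endpoint \<open>s = 1\<close>.
\<close>

lemma (in finite_measure) head_norm_le_half:
  assumes f: "f \<in> borel_measurable M" and p: "0 < p"
  shows "head_norm M p f s \<le> ennreal (2 powr (1 / p)) * head_norm M p f (s / 2)"
proof -
  have "(\<integral>\<^sup>+\<sigma>\<in>{0<..<s}. ennreal (decr_rearr M f \<sigma> powr p) \<partial>lborel)
      \<le> (\<integral>\<^sup>+\<sigma>\<in>{0<..<s}. ennreal (decr_rearr M f (\<sigma> / 2) powr p) \<partial>lborel)"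
    using p by (intro nn_integral_mono)
      (auto simp: indicator_def intro!: ennreal_leI powr_mono2 decr_rearr_antimono decr_rearr_nonneg f)
  also have "\<dots> = ennreal 2 * (\<integral>\<^sup>+\<sigma>\<in>{0<..<s / 2}. ennreal (decr_rearr M f \<sigma> powr p) \<partial>lborel)"
    using nn_integral_decr_rearr_half[OF f, of "\<lambda>y. ennreal (y powr p)" s] by simp
  finally show ?thesis
    unfolding head_norm_def using p by (subst ennpowr_cmult[symmetric]) (auto intro: ennpowr_mono)
qed

lemma powr_add_le:
  fixes a b p :: real
  assumes "0 \<le> a" "0 \<le> b" "0 \<le> p"
  shows "(a + b) powr p \<le> 2 powr p * (a powr p + b powr p)"
proof -
  have "(a + b) powr p \<le> (2 * max a b) powr p"
    using assms by (intro powr_mono2) auto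
  also have "\<dots> = 2 powr p * max a b powr p" using assms by (simp add: powr_mult)
  also have "\<dots> \<le> 2 powr p * (a powr p + b powr p)"
    by (intro mult_left_mono) (auto simp: max_def)
  finally show ?thesis .
qed

text \<open>
  The splitting of \<open>f\<^sub>*\<close> evaluates the two rearrangements at \<open>\<sigma> / 2\<close>; rescaling costs a factor
  2 and leaves integrals over \<open>(0, s / 2)\<close>, which are enlarged to \<open>(0, s)\<close>. The constant
  factor that this loses is harmless for equivalence of norms.
\<close>

lemma (in finite_measure) head_norm_add_le:
  assumes f: "f \<in> borel_measurable M" "f0 \<in> borel_measurable M" "f1 \<in> borel_measurable M"
    and ae: "AE x in M. f x = f0 x + f1 x" and p: "0 < p"
  shows "head_norm M p f s
    \<le> ennreal (2 * 2 powr (1 / p) * 2 powr (1 / p)) * (head_norm M p f0 s + head_norm M p f1 s)"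
proof -
  define I where "I f t = (\<integral>\<^sup>+\<sigma>\<in>{0<..<t}. ennreal (decr_rearr M f \<sigma> powr p) \<partial>lborel)"
    for f :: "'a \<Rightarrow> real" and t
  have half: "(\<integral>\<^sup>+\<sigma>\<in>{0<..<s}. ennreal (decr_rearr M g (\<sigma> / 2) powr p) \<partial>lborel) \<le> ennreal 2 * I g s"
    if "g \<in> borel_measurable M" for g
  proof -
    have "I g (s / 2) \<le> I g s"
      unfolding I_def by (rule nn_integral_mono) (auto simp: indicator_def)
    then have "ennreal 2 * I g (s / 2) \<le> ennreal 2 * I g s" by (intro mult_left_mono) auto
    then show ?thesis
      using nn_integral_decr_rearr_half[OF that, of "\<lambda>y. ennreal (y powr p)" s] by (simp add: I_def)
  qed
  have m: "(\<lambda>\<sigma>. ennreal (decr_rearr M g (\<sigma> / 2) powr p) * indicator {0<..<s} \<sigma>) \<in> borel_measurable lborel"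
    if "g \<in> borel_measurable M" for g
  proof -
    have "(\<lambda>\<sigma>. ennreal (decr_rearr M g (\<sigma> / 2) powr p) * indicator {0<..<s/2} (\<sigma> / 2)) \<in> borel_measurable borel"
      by (rule measurable_compose[OF _ measurable_decr_rearr_indicator[OF that]]) simp_all
    moreover have "indicator {0<..<s / 2} (\<sigma> / 2) = (indicator {0<..<s} \<sigma> :: ennreal)" for \<sigma>
      by (auto simp: indicator_def)
    ultimately show ?thesis by simp
  qed
  have "I f s \<le> (\<integral>\<^sup>+\<sigma>. ennreal (2 powr p) *
       (ennreal (decr_rearr M f0 (\<sigma> / 2) powr p) * indicator {0<..<s} \<sigma>
      + ennreal (decr_rearr M f1 (\<sigma> / 2) powr p) * indicator {0<..<s} \<sigma>) \<partial>lborel)"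
    unfolding I_def
  proof (rule nn_integral_mono)
    fix \<sigma> :: real
    show "ennreal (decr_rearr M f \<sigma> powr p) * indicator {0<..<s} \<sigma> \<le> ennreal (2 powr p) *
       (ennreal (decr_rearr M f0 (\<sigma> / 2) powr p) * indicator {0<..<s} \<sigma>
      + ennreal (decr_rearr M f1 (\<sigma> / 2) powr p) * indicator {0<..<s} \<sigma>)"
    proof (cases "\<sigma> \<in> {0<..<s}")
      case True
      then have s: "0 < \<sigma>" by simp
      have "decr_rearr M f \<sigma> powr p \<le> (decr_rearr M f0 (\<sigma> / 2) + decr_rearr M f1 (\<sigma> / 2)) powr p"
        using p s f ae by (intro powr_mono2 decr_rearr_add_le decr_rearr_nonneg) auto
      also have "\<dots> \<le> 2 powr p * (decr_rearr M f0 (\<sigma> / 2) powr p + decr_rearr M f1 (\<sigma> / 2) powr p)"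
        using p s f by (intro powr_add_le decr_rearr_nonneg) auto
      finally show ?thesis using True
        by (simp flip: ennreal_plus ennreal_mult)
    qed simp
  qed
  also have "\<dots> = ennreal (2 powr p) * ((\<integral>\<^sup>+\<sigma>\<in>{0<..<s}. ennreal (decr_rearr M f0 (\<sigma> / 2) powr p) \<partial>lborel)
      + (\<integral>\<^sup>+\<sigma>\<in>{0<..<s}. ennreal (decr_rearr M f1 (\<sigma> / 2) powr p) \<partial>lborel))"
    using m[OF f(2)] m[OF f(3)] by (simp add: nn_integral_cmult nn_integral_add)
  also have "\<dots> \<le> ennreal (2 powr p) * (ennreal 2 * I f0 s + ennreal 2 * I f1 s)"
    by (intro mult_left_mono add_mono half f) auto
  also have "\<dots> = ennreal (2 powr p * 2) * (I f0 s + I f1 s)"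
    by (simp add: ennreal_mult distrib_left mult.assoc)
  finally have "head_norm M p f s \<le> ennpowr (ennreal (2 powr p * 2) * (I f0 s + I f1 s)) (1 / p)"
    using p by (simp add: head_norm_def I_def ennpowr_mono)
  also have "\<dots> = ennreal ((2 powr p * 2) powr (1 / p)) * ennpowr (I f0 s + I f1 s) (1 / p)"
    by (rule ennpowr_cmult) simp
  also have "\<dots> \<le> ennreal ((2 powr p * 2) powr (1 / p)) *
      (ennreal (2 powr (1 / p)) * (ennpowr (I f0 s) (1 / p) + ennpowr (I f1 s) (1 / p)))"
    using p by (intro mult_left_mono ennpowr_add_le) auto
  also have "\<dots> = ennreal (2 * 2 powr (1 / p) * 2 powr (1 / p)) * (head_norm M p f0 s + head_norm M p f1 s)"
    using p by (simp add: head_norm_def I_def powr_mult powr_powr ennreal_mult mult.assoc)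
  finally show ?thesis .
qed

lemma (in prob_space) fnorm_Lp_eq_head_norm:
  assumes "f \<in> borel_measurable M"
  shows "fnorm (Lp M p) f = head_norm M p f 1"
  using nn_integral_decr_rearr[OF assms, of "\<lambda>y. ennreal (y powr p)"]
  by (simp add: fnorm_Lp head_norm_def)

section \<open>The logarithmic change of variable\<close>

lemma DERIV_neg_log_powr:
  assumes "0 < s" "s \<le> (1::real)"
  shows "((\<lambda>s. (1 - ln s) powr (- r)) has_real_derivative r * (1 - ln s) powr (- r - 1) / s) (at s)"
proof -
  have "ln s \<le> 0" using assms by simp
  then have "0 < 1 - ln s" by linarith
  then show ?thesis using assms by (auto intro!: derivative_eq_intros simp: field_simps)
qed

text \<open>
  The substitution \<open>t = (1 - ln s) powr (- q)\<close> on \<open>(0, 1)\<close>. Its derivative is unbounded near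
  \<open>s = 0\<close>, so it is carried out on compact intervals that exhaust \<open>(0, 1]\<close>.
\<close>

lemma nn_integral_log_substitution:
  fixes h :: "real \<Rightarrow> ennreal"
  assumes h[measurable]: "h \<in> borel_measurable borel" and q: "0 < q"
  shows "(\<integral>\<^sup>+t\<in>{0<..<1}. h t \<partial>lborel) =
    (\<integral>\<^sup>+s\<in>{0<..<1}. h ((1 - ln s) powr (- q)) * ennreal (q * (1 - ln s) powr (- q - 1) / s) \<partial>lborel)"
proof -
  \<comment> \<open>the points that the substitution maps to \<open>1 / (k + 1)\<close>\<close>
  define a where "a k = exp (1 - real (Suc k) powr (1 / q))" for k
  have a: "0 < a k" "a k \<le> 1" "(1 - ln (a k)) powr (- q) = inverse (real (Suc k))" for k
    using q by (auto simp: a_def powr_powr powr_minus ge_one_powr_ge_zero)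
  let ?g = "\<lambda>s::real. h ((1 - ln s) powr (- q)) * ennreal (q * (1 - ln s) powr (- q - 1) / s)"
  have part: "(\<integral>\<^sup>+t\<in>{inverse (real (Suc k))..1}. h t \<partial>lborel) = (\<integral>\<^sup>+s\<in>{a k..1}. ?g s \<partial>lborel)" for k
  proof (cases "a k < 1")
    case True
    have "(\<integral>\<^sup>+t. h t * indicator {(1 - ln (a k)) powr (- q)..(1 - ln 1) powr (- q)} t \<partial>lborel) = (\<integral>\<^sup>+s\<in>{a k..1}. ?g s \<partial>lborel)"
    proof (rule nn_integral_substitution_aux[OF h _ _ _ _ True])
      fix x assume x: "x \<in> {a k..1}"
      with a[of k] have x': "0 < x" "x \<le> 1" by auto
      show "((\<lambda>s. (1 - ln s) powr (- q)) has_real_derivative q * (1 - ln x) powr (- q - 1) / x) (at x)"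
        by (rule DERIV_neg_log_powr) fact+
      show "0 \<le> q * (1 - ln x) powr (- q - 1) / x" using x' q by simp
    next
      have "0 < x \<and> ln x \<le> 0" if "x \<in> {a k..1}" for x
        using that a[of k] less_le_trans[of 0 "a k" x] by simp
      then show "continuous_on {a k..1} (\<lambda>s. q * (1 - ln s) powr (- q - 1) / s)"
        by (intro continuous_intros) force+
    qed simp
    then show ?thesis by (simp add: a)
  next
    case False
    with a[of k] have e: "a k = 1" by (simp add: order.antisym)
    then have "inverse (real (Suc k)) = 1" using a(3)[of k] by simp
    then have "{inverse (real (Suc k))..1} = {1}" "{a k..1} = {1}" using e by auto
    then show ?thesis by simp
  qed
  have m[measurable]: "?g \<in> borel_measurable borel" by measurable
  have dens: "(\<integral>\<^sup>+t\<in>A. h' t \<partial>lborel) = emeasure (density lborel h') A"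
    if "A \<in> sets borel" "h' \<in> borel_measurable borel" for A and h' :: "real \<Rightarrow> ennreal"
    using that by (simp add: emeasure_density)
  have lim: "(\<integral>\<^sup>+t\<in>{0<..<1}. h' t \<partial>lborel) = (SUP k. \<integral>\<^sup>+t\<in>{b k..1}. h' t \<partial>lborel)"
    if h'[measurable]: "h' \<in> borel_measurable borel" and b: "decseq b" "\<And>k. 0 < b k" "b \<longlonglongrightarrow> 0"
    for h' :: "real \<Rightarrow> ennreal" and b :: "nat \<Rightarrow> real"
  proof -
    have "(\<integral>\<^sup>+t\<in>{0<..<1}. h' t \<partial>lborel) = (\<integral>\<^sup>+t\<in>{0<..1}. h' t \<partial>lborel)"
      by (rule nn_integral_cong_AE, rule eventually_mono[OF AE_lborel_singleton[of 1]])
         (auto simp: indicator_def)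
    also have "{0<..1} = (\<Union>k. {b k..1})"
    proof safe
      fix x :: real assume "x \<in> {0<..1}"
      then have "eventually (\<lambda>k. b k < x) sequentially" using b(3) by (intro order_tendstoD) auto
      then obtain k where "b k < x" by (auto simp: eventually_sequentially)
      then show "x \<in> (\<Union>k. {b k..1})" using \<open>x \<in> {0<..1}\<close> by (auto intro!: exI[of _ k])
    qed (use b in \<open>auto intro: less_le_trans\<close>)
    also have "(\<integral>\<^sup>+t\<in>(\<Union>k. {b k..1}). h' t \<partial>lborel) = (SUP k. \<integral>\<^sup>+t\<in>{b k..1}. h' t \<partial>lborel)"
    proof -
      have "incseq (\<lambda>k. {b k..1})" using b(1) by (auto simp: incseq_def decseq_def intro: order.trans)
      then have "(SUP k. emeasure (density lborel h') {b k..1}) = emeasure (density lborel h') (\<Union>k. {b k..1})"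
        by (intro SUP_emeasure_incseq) auto
      then show ?thesis by (simp add: dens)
    qed
    finally show ?thesis .
  qed
  have ai: "decseq (\<lambda>k. inverse (real (Suc k)))"
    by (auto simp: decseq_def field_simps)
  have aa: "decseq a" unfolding decseq_def a_def using q by (auto intro!: powr_mono2)
  have al: "a \<longlonglongrightarrow> 0"
  proof -
    have "filterlim (\<lambda>k. real (Suc k) powr (1 / q)) at_top sequentially"
      using q by (intro filterlim_compose[OF real_powr_at_top]
        filterlim_compose[OF filterlim_real_sequentially filterlim_Suc]) auto
    then have "filterlim (\<lambda>k. - (real (Suc k) powr (1 / q))) at_bot sequentially"
      by (rule filterlim_uminus_at_top[THEN iffD1])
    then have "filterlim (\<lambda>k. 1 - real (Suc k) powr (1 / q)) at_bot sequentially"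
      using filterlim_tendsto_add_at_bot_iff[OF tendsto_const[of "1::real"],
          of "\<lambda>k. - (real (Suc k) powr (1 / q))" sequentially] by simp
    then show ?thesis unfolding a_def by (rule filterlim_compose[OF exp_at_bot])
  qed
  show ?thesis
    by (subst lim[OF h ai _ LIMSEQ_inverse_real_of_nat], simp, subst lim[OF m aa a(1) al])
       (simp only: part)
qed

section \<open>The lower bound for the K-functional\<close>

lemma nn_integral_log_weight:
  assumes q: "0 < q" and s: "0 < s" "s \<le> (1::real)"
  shows "(\<integral>\<^sup>+t\<in>{s..1}. ennreal ((1 - ln t) powr (q - 1) / t) \<partial>lborel) = ennreal (((1 - ln s) powr q - 1) / q)"
proof -
  have "(\<integral>\<^sup>+t. ennreal ((1 - ln t) powr (q - 1) / t) * indicator {s..1} t \<partial>lborel)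
      = ennreal (- ((1 - ln 1) powr q) / q - (- ((1 - ln s) powr q) / q))"
  proof (rule nn_integral_FTC_Icc)
    fix t assume "t \<in> {s..1}"
    then have t: "0 < t" "t \<le> 1" using s by auto
    have "((\<lambda>t. - ((1 - ln t) powr (- (- q))) / q) has_real_derivative
        - ((- q) * (1 - ln t) powr (- (- q) - 1) / t) / q) (at t)"
      by (intro DERIV_cdivide DERIV_minus DERIV_neg_log_powr t)
    moreover have "- ((- q) * (1 - ln t) powr (- (- q) - 1) / t) / q = (1 - ln t) powr (q - 1) / t"
      using q by simp
    ultimately show "((\<lambda>t. - ((1 - ln t) powr q) / q) has_real_derivative (1 - ln t) powr (q - 1) / t)
        (at t)"
      unfolding minus_minus by metis
    show "0 \<le> (1 - ln t) powr (q - 1) / t" using t by simp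
  qed (measurable, use s in simp)
  also have "- ((1 - ln 1) powr q) / q - (- ((1 - ln s) powr q) / q) = ((1 - ln s) powr q - 1) / q"
    by (simp add: diff_divide_distrib)
  finally show ?thesis .
qed

text \<open>
  As \<open>F\<close> is increasing, the norm of index 1 is at least \<open>F(s / 2)\<close> times the integral of
  the weight over \<open>(s / 2, 1)\<close>, which is of the order \<open>(1 - ln s) powr q\<close>. Starting at \<open>s / 2\<close>
  rather than at \<open>s\<close> matters: the integral of the weight over \<open>(s, 1)\<close> vanishes as \<open>s\<close> tends to 1.
\<close>

lemma (in finite_measure) head_norm_le_small_Lebesgue:
  fixes p s :: real
  defines "q \<equiv> 1 - 1 / p"
  assumes f: "f \<in> borel_measurable M" and p: "1 < p" and s: "0 < s" "s < 1"
  shows "head_norm M p f s \<le> ennreal (2 powr (1 / p) * q / (1 - (1 + ln 2) powr (- q)) * (1 - ln s) powr (- q))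
           * fnorm (small_Lebesgue M p 1) f"
proof -
  have q: "0 < q" using p by (simp add: q_def)
  define c where "c = 1 - (1 + ln 2 :: real) powr (- q)"
  define L where "L = 1 - ln s"
  have L: "1 \<le> L" using s by (simp add: L_def)
  have ln2: "0 < ln (2::real)" by simp
  then have "1 < (1 + ln 2 :: real) powr q" using q by (intro gr_one_powr) auto
  then have c: "0 < c"
    by (simp add: c_def powr_minus inverse_eq_divide divide_less_eq)
  have key: "c * L powr q \<le> (L + ln 2) powr q - 1"
  proof -
    have "c * L powr q \<le> c * (L + ln 2) powr q"
      using q L ln2 c by (intro mult_left_mono powr_mono2) auto
    also have "\<dots> = (L + ln 2) powr q - ((L + ln 2) / (1 + ln 2)) powr q"
    proof -
      have "((L + ln 2) / (1 + ln 2)) powr q = (L + ln 2) powr q * (1 + ln 2) powr (- q)"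
        using L ln2 by (simp add: powr_divide powr_minus_divide)
      then show ?thesis by (simp add: c_def algebra_simps)
    qed
    \<comment> \<open>the subtracted quotient is at least 1 because \<open>1 \<le> L\<close>\<close>
    also have "\<dots> \<le> (L + ln 2) powr q - 1"
    proof (intro diff_left_mono ge_one_powr_ge_zero)
      show "1 \<le> (L + ln 2) / (1 + ln 2)"
        using L ln2 add_pos_pos[OF zero_less_one ln2] by (subst le_divide_eq_1_pos) auto
    qed (use q in simp)
    finally show ?thesis .
  qed
  let ?h = "head_norm M p f (s / 2)" and ?w = "\<lambda>t. ennreal ((1 - ln t) powr (q - 1) / t)"
  have weight: "(\<integral>\<^sup>+t\<in>{s/2..1}. ?w t \<partial>lborel) = ennreal (((L + ln 2) powr q - 1) / q)"
  proof -
    have "L + ln 2 = 1 - ln (s / 2)" using s by (simp add: L_def ln_div)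
    then show ?thesis using nn_integral_log_weight[of q "s / 2"] q s by simp
  qed
  have "ennreal (c * L powr q / q) * ?h \<le> ennreal (((L + ln 2) powr q - 1) / q) * ?h"
    using key q by (intro mult_right_mono ennreal_leI divide_right_mono) auto
  also have "\<dots> = (\<integral>\<^sup>+t. ?w t * indicator {s/2..1} t * ?h \<partial>lborel)"
    unfolding weight[symmetric] by (rule nn_integral_multc[symmetric]) measurable
  also have "\<dots> \<le> (\<integral>\<^sup>+t\<in>{0<..<1}. ennreal ((1 - ln t) powr (q - 1) / t) * head_norm M p f t \<partial>lborel)"
  proof (rule nn_integral_mono_AE, rule eventually_mono[OF AE_lborel_singleton[of 1]])
    fix t :: real assume "t \<noteq> 1"
    have "head_norm M p f (s / 2) \<le> head_norm M p f t" if "s / 2 \<le> t"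
      using that p by (intro head_norm_mono) auto
    then show "?w t * indicator {s/2..1} t * ?h
        \<le> ennreal ((1 - ln t) powr (q - 1) / t) * head_norm M p f t * indicator {0<..<1} t"
      using \<open>t \<noteq> 1\<close> s by (auto simp: indicator_def intro: mult_left_mono)
  qed
  also have "\<dots> = fnorm (small_Lebesgue M p 1) f"
    by (simp add: fnorm_small_Lebesgue q_def)
  finally have *: "ennreal (c * L powr q / q) * head_norm M p f (s / 2) \<le> fnorm (small_Lebesgue M p 1) f" .
  have "2 powr (1 / p) = (2 powr (1 / p) * q / c * L powr (- q)) * (c * L powr q / q)"
  proof -
    have "L powr (- q) * L powr q = 1" using L by (simp flip: powr_add)
    moreover have "(a * q / c * X) * (c * Y / q) = a * (X * Y)" for a X Y :: real
      using c q by simp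
    ultimately show ?thesis by simp
  qed
  moreover have "0 \<le> 2 powr (1 / p) * q / c * L powr (- q)" "0 \<le> c * L powr q / q"
    using c q by auto
  ultimately have split: "ennreal (2 powr (1 / p))
      = ennreal (2 powr (1 / p) * q / c * L powr (- q)) * ennreal (c * L powr q / q)"
    by (metis ennreal_mult)
  have "head_norm M p f s \<le> ennreal (2 powr (1 / p)) * ?h"
    using f p by (intro head_norm_le_half) auto
  also have "\<dots> = ennreal (2 powr (1 / p) * q / c * L powr (- q)) * (ennreal (c * L powr q / q) * ?h)"
    unfolding split by (rule mult.assoc)
  also have "\<dots> \<le> ennreal (2 powr (1 / p) * q / c * L powr (- q)) * fnorm (small_Lebesgue M p 1) f"
    by (intro mult_left_mono *) auto
  finally show ?thesis unfolding c_def L_def .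
qed

text \<open>
  The constant must not depend on \<open>f\<close> or \<open>s\<close>; for every decomposition the bound combines the
  quasi-triangle inequality for \<open>F\<close> with the separate bounds for the two parts.
\<close>

lemma (in prob_space) head_norm_le_K_functional:
  fixes p :: real
  assumes p: "1 < p"
  shows "\<exists>c>0. \<forall>f\<in>borel_measurable M. \<forall>s\<in>{0<..<1}. head_norm M p f s
      \<le> ennreal c * K_functional M (Lp M p) (small_Lebesgue M p 1) f ((1 - ln s) powr (- (1 - 1 / p)))"
proof -
  define q where "q = 1 - 1 / p"
  have q: "0 < q" using p by (simp add: q_def)
  define A where "A = 2 * 2 powr (1 / p) * 2 powr (1 / p)"
  define B where "B = 2 powr (1 / p) * q / (1 - (1 + ln 2) powr (- q))"
  let ?c = "A * (1 + \<bar>B\<bar>)"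
  have A: "0 < A" by (simp add: A_def)
  then have c: "0 < ?c" by (intro mult_pos_pos) auto
  have bound: "head_norm M p f s \<le> ennreal ?c * K_functional M (Lp M p) (small_Lebesgue M p 1) f ((1 - ln s) powr (- q))"
    if f: "f \<in> borel_measurable M" and s: "s \<in> {0<..<1}" for f s
  proof -
    let ?t = "(1 - ln s) powr (- q)"
    have "ennreal (1 / ?c) * head_norm M p f s \<le> fnorm (Lp M p) f0 + ennreal ?t * fnorm (small_Lebesgue M p 1) f1"
      if "(f0, f1) \<in> decompositions M (Lp M p) (small_Lebesgue M p 1) f" for f0 f1
    proof -
      have f0: "f0 \<in> borel_measurable M" and f1: "f1 \<in> borel_measurable M" and ae: "AE x in M. f x = f0 x + f1 x"
        using that by (auto simp: decompositions_def carr_Lp carr_small_Lebesgue)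
      let ?N0 = "fnorm (Lp M p) f0" and ?N1 = "fnorm (small_Lebesgue M p 1) f1"
      have h0: "head_norm M p f0 s \<le> ?N0"
        using s p by (simp add: fnorm_Lp_eq_head_norm[OF f0] head_norm_mono)
      have h1: "head_norm M p f1 s \<le> ennreal (B * ?t) * ?N1"
        using head_norm_le_small_Lebesgue[OF f1 p, of s] s by (simp add: B_def q_def)
      have "head_norm M p f s \<le> ennreal A * (head_norm M p f0 s + head_norm M p f1 s)"
        using head_norm_add_le[OF f f0 f1 ae, of p s] p by (simp add: A_def)
      also have "\<dots> \<le> ennreal A * (ennreal (1 + \<bar>B\<bar>) * ?N0 + ennreal (1 + \<bar>B\<bar>) * (ennreal ?t * ?N1))"
      proof (intro mult_left_mono add_mono)
        have "?N0 = ennreal 1 * ?N0" by simp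
        also have "\<dots> \<le> ennreal (1 + \<bar>B\<bar>) * ?N0" by (intro mult_right_mono ennreal_leI) auto
        finally show "head_norm M p f0 s \<le> ennreal (1 + \<bar>B\<bar>) * ?N0" using h0 by (rule order.trans[rotated])
        have "ennreal (B * ?t) * ?N1 \<le> ennreal ((1 + \<bar>B\<bar>) * ?t) * ?N1"
          by (intro mult_right_mono ennreal_leI) auto
        also have "\<dots> = ennreal (1 + \<bar>B\<bar>) * (ennreal ?t * ?N1)"
          by (simp add: ennreal_mult mult.assoc)
        finally show "head_norm M p f1 s \<le> ennreal (1 + \<bar>B\<bar>) * (ennreal ?t * ?N1)"
          using h1 by (rule order.trans[rotated])
      qed auto
      also have "\<dots> = ennreal ?c * (?N0 + ennreal ?t * ?N1)"
      proof -
        have eq: "ennreal ?c = ennreal A * ennreal (1 + \<bar>B\<bar>)" using A by (intro ennreal_mult) auto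
        show ?thesis unfolding eq by (simp only: distrib_left mult.assoc)
      qed
      finally have "ennreal (1 / ?c) * head_norm M p f s \<le> ennreal (1 / ?c) * (ennreal ?c * (?N0 + ennreal ?t * ?N1))"
        by (intro mult_left_mono) auto
      also have "\<dots> = ennreal (1 / ?c * ?c) * (?N0 + ennreal ?t * ?N1)"
        using c by (subst ennreal_mult) (auto simp only: mult.assoc divide_nonneg_nonneg zero_le_one less_imp_le)
      also have "1 / ?c * ?c = 1" using c by (intro nonzero_eq_divide_eq[THEN iffD1]) auto
      finally show ?thesis by simp
    qed
    then have "ennreal (1 / ?c) * head_norm M p f s \<le> K_functional M (Lp M p) (small_Lebesgue M p 1) f ?t"
      unfolding K_functional_def by (intro INF_greatest) auto
    then have "ennreal ?c * (ennreal (1 / ?c) * head_norm M p f s) \<le> ennreal ?c * K_functional M (Lp M p) (small_Lebesgue M p 1) f ?t"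
      by (intro mult_left_mono) auto
    moreover have "ennreal ?c * (ennreal (1 / ?c) * head_norm M p f s) = ennreal (?c * (1 / ?c)) * head_norm M p f s"
      using c by (subst ennreal_mult) (auto simp only: mult.assoc divide_nonneg_nonneg zero_le_one less_imp_le)
    moreover have "?c * (1 / ?c) = 1" using c by (metis nonzero_mult_div_cancel_left times_divide_eq_right mult.right_neutral less_irrefl)
    ultimately show ?thesis by simp
  qed
  then show ?thesis using c unfolding q_def by blast
qed

section \<open>The upper bound for the K-functional\<close>

lemma (in finite_measure) decr_rearr_times_powr_le_head_norm:
  assumes f: "f \<in> borel_measurable M" and p: "0 < p" and s: "0 < s"
  shows "ennreal (decr_rearr M f s * s powr (1 / p)) \<le> head_norm M p f s"
proof -
  let ?l = "decr_rearr M f s"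
  have l: "0 \<le> ?l" using f s by (rule decr_rearr_nonneg)
  have "ennreal (?l powr p * s) = (\<integral>\<^sup>+\<sigma>\<in>{0<..<s}. ennreal (?l powr p) \<partial>lborel)"
    using s by (simp add: nn_integral_cmult_indicator ennreal_mult)
  also have "\<dots> \<le> (\<integral>\<^sup>+\<sigma>\<in>{0<..<s}. ennreal (decr_rearr M f \<sigma> powr p) \<partial>lborel)"
    using p s l f by (intro nn_integral_mono)
      (auto simp: indicator_def intro!: ennreal_leI powr_mono2 decr_rearr_antimono)
  finally have "ennpowr (ennreal (?l powr p * s)) (1 / p) \<le> head_norm M p f s"
    unfolding head_norm_def using p by (intro ennpowr_mono) auto
  then show ?thesis using p s l by (simp add: ennpowr_ennreal powr_mult powr_powr)
qed

lemma (in finite_measure) head_norm_le_bounded: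
  assumes f: "f \<in> borel_measurable M" and b: "\<And>x. x \<in> space M \<Longrightarrow> \<bar>f x\<bar> \<le> c" and c: "0 \<le> c"
    and p: "0 < p" and s: "0 < s"
  shows "head_norm M p f s \<le> ennreal (c * s powr (1 / p))"
proof -
  have "(\<integral>\<^sup>+\<sigma>\<in>{0<..<s}. ennreal (decr_rearr M f \<sigma> powr p) \<partial>lborel)
     \<le> (\<integral>\<^sup>+\<sigma>\<in>{0<..<s}. ennreal (c powr p) \<partial>lborel)"
    using p s f c b by (intro nn_integral_mono)
      (auto simp: indicator_def intro!: ennreal_leI powr_mono2 decr_rearr_nonneg decr_rearr_le_bound)
  also have "\<dots> = ennreal (c powr p * s)"
    using s by (simp add: nn_integral_cmult_indicator ennreal_mult)
  finally have "head_norm M p f s \<le> ennpowr (ennreal (c powr p * s)) (1 / p)"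
    unfolding head_norm_def using p by (intro ennpowr_mono) auto
  then show ?thesis using p s c by (simp add: ennpowr_ennreal powr_mult powr_powr)
qed

lemma (in finite_measure) head_norm_mono_fun:
  assumes "f \<in> borel_measurable M" "g \<in> borel_measurable M"
    and "\<And>x. x \<in> space M \<Longrightarrow> \<bar>f x\<bar> \<le> \<bar>g x\<bar>" "0 < p"
  shows "head_norm M p f s \<le> head_norm M p g s"
  unfolding head_norm_def using assms
  by (intro ennpowr_mono nn_integral_mono)
     (auto simp: indicator_def intro!: ennreal_leI powr_mono2 decr_rearr_nonneg decr_rearr_mono_fun)

lemma nn_integral_powr_from_0:
  assumes "-1 < a" "0 \<le> c"
  shows "(\<integral>\<^sup>+x\<in>{0<..<c}. ennreal (x powr a) \<partial>lborel) = ennreal (c powr (a + 1) / (a + 1))"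
proof -
  have "(\<integral>\<^sup>+x\<in>{0<..<c}. ennreal (x powr a) \<partial>lborel) = (\<integral>\<^sup>+x\<in>{0..c}. ennreal (x powr a) \<partial>lborel)"
    by (rule nn_integral_cong_AE, rule eventually_mono[OF eventually_conj[OF AE_lborel_singleton[of 0] AE_lborel_singleton[of c]]])
       (auto simp: indicator_def)
  also have "\<dots> = ennreal (c powr (a + 1) / (a + 1))"
    by (rule nn_integral_has_integral_lebesgue'[OF _ has_integral_powr_from_0]) (use assms in auto)
  finally show ?thesis .
qed

text \<open>
  By equimeasurability the \<open>L\<^sup>p\<close> norm of the excess of \<open>\<bar>f\<bar>\<close> over the height \<open>f\<^sub>*(s)\<close> is that of the
  excess of \<open>f\<^sub>*\<close>, which vanishes from \<open>s\<close> on.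
\<close>

lemma (in prob_space) fnorm_Lp_excess_le:
  assumes f[measurable]: "f \<in> borel_measurable M" "g \<in> borel_measurable M" and p: "0 < p" and s: "0 < s"
    and g: "\<And>x. x \<in> space M \<Longrightarrow> \<bar>g x\<bar> = max 0 (\<bar>f x\<bar> - decr_rearr M f s)"
  shows "fnorm (Lp M p) g \<le> head_norm M p f s"
proof -
  let ?l = "decr_rearr M f s"
  let ?h = "\<lambda>y. ennreal (max 0 (y - ?l) powr p)"
  have "(\<integral>\<^sup>+x. ennreal (\<bar>g x\<bar> powr p) \<partial>M) = (\<integral>\<^sup>+x. ?h \<bar>f x\<bar> \<partial>M)"
    by (rule nn_integral_cong) (simp add: g)
  also have "\<dots> = (\<integral>\<^sup>+\<sigma>\<in>{0<..<1}. ?h (decr_rearr M f \<sigma>) \<partial>lborel)"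
    by (rule nn_integral_decr_rearr[symmetric]) auto
  also have "\<dots> \<le> (\<integral>\<^sup>+\<sigma>\<in>{0<..<s}. ennreal (decr_rearr M f \<sigma> powr p) \<partial>lborel)"
  proof (rule nn_integral_mono)
    fix \<sigma> :: real
    consider "\<sigma> \<le> 0" | "0 < \<sigma>" "\<sigma> < s" | "0 < \<sigma>" "s \<le> \<sigma>" by linarith
    then show "?h (decr_rearr M f \<sigma>) * indicator {0<..<1} \<sigma> \<le> ennreal (decr_rearr M f \<sigma> powr p) * indicator {0<..<s} \<sigma>"
    proof cases
      case 2
      have "0 \<le> ?l" "0 \<le> decr_rearr M f \<sigma>" using f s 2 by (auto intro: decr_rearr_nonneg)
      then have "max 0 (decr_rearr M f \<sigma> - ?l) powr p \<le> decr_rearr M f \<sigma> powr p"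
        using p by (intro powr_mono2) auto
      then show ?thesis using 2 by (auto simp: indicator_def intro: ennreal_leI)
    next
      case 3
      then have "decr_rearr M f \<sigma> \<le> ?l" using f s by (intro decr_rearr_antimono) auto
      then show ?thesis using p by (simp add: max_def)
    qed simp
  qed
  finally show ?thesis
    unfolding fnorm_Lp head_norm_def using p by (intro ennpowr_mono) auto
qed

text \<open>
  The decomposition truncates \<open>f\<close> at height \<open>l = f\<^sub>*(s)\<close>. For the bounded part \<open>f1\<close>, \<open>F\<close> is at
  most \<open>F\<^sub>f(\<tau>)\<close> when \<open>\<tau> > s\<close> and at most \<open>l * \<tau> powr (1 / p)\<close> when \<open>\<tau> < s\<close>, where the
  logarithmic weight is at most \<open>1 / \<tau>\<close>; the integral of the resulting bound is
  \<open>p * l * s powr (1 / p)\<close>, which is at most \<open>p * F\<^sub>f(s)\<close>.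
\<close>

lemma (in prob_space) K_functional_le:
  fixes p s t :: real
  assumes f[measurable]: "f \<in> borel_measurable M" and p: "1 < p" and s: "0 < s" "s < 1" and t: "0 < t"
  shows "K_functional M (Lp M p) (small_Lebesgue M p 1) f t \<le> head_norm M p f s
    + ennreal t * ((\<integral>\<^sup>+\<tau>\<in>{s<..<1}. ennreal ((1 - ln \<tau>) powr (- 1 / p) / \<tau>) * head_norm M p f \<tau> \<partial>lborel)
        + ennreal p * head_norm M p f s)" (is "_ \<le> ?H + ennreal t * (?I + _)")
proof -
  define l where "l = decr_rearr M f s"
  define f1 where "f1 = (\<lambda>x. max (- l) (min l (f x)))"
  define f0 where "f0 = (\<lambda>x. f x - f1 x)"
  have l: "0 \<le> l" unfolding l_def using f s by (intro decr_rearr_nonneg)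
  have m[measurable]: "f0 \<in> borel_measurable M" "f1 \<in> borel_measurable M"
    by (simp_all add: f0_def f1_def)
  have N0: "fnorm (Lp M p) f0 \<le> ?H"
    by (rule fnorm_Lp_excess_le) (use p s l in \<open>auto simp: f0_def f1_def l_def[symmetric]\<close>)
  let ?w = "\<lambda>\<tau>. ennreal ((1 - ln \<tau>) powr (- 1 / p) / \<tau>)"
  note [measurable] = measurable_head_norm[of p M f]
  have "fnorm (small_Lebesgue M p 1) f1 = (\<integral>\<^sup>+\<tau>\<in>{0<..<1}. ?w \<tau> * head_norm M p f1 \<tau> \<partial>lborel)"
    by (simp add: fnorm_small_Lebesgue)
  also have "\<dots> \<le> (\<integral>\<^sup>+\<tau>. ?w \<tau> * head_norm M p f \<tau> * indicator {s<..<1} \<tau>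
        + ennreal l * (ennreal (\<tau> powr (1 / p - 1)) * indicator {0<..<s} \<tau>) \<partial>lborel)"
  proof (rule nn_integral_mono_AE, rule eventually_mono[OF AE_lborel_singleton[of s]])
    fix \<tau> :: real assume "\<tau> \<noteq> s"
    then consider "\<tau> \<le> 0 \<or> 1 \<le> \<tau>" | "0 < \<tau>" "\<tau> < s" | "s < \<tau>" "\<tau> < 1" by linarith
    then show "?w \<tau> * head_norm M p f1 \<tau> * indicator {0<..<1} \<tau> \<le> ?w \<tau> * head_norm M p f \<tau> * indicator {s<..<1} \<tau>
        + ennreal l * (ennreal (\<tau> powr (1 / p - 1)) * indicator {0<..<s} \<tau>)"
    proof cases
      case 2
      have "head_norm M p f1 \<tau> \<le> ennreal (l * \<tau> powr (1 / p))"
        by (rule head_norm_le_bounded) (use l p 2 in \<open>auto simp: f1_def\<close>)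
      then have "?w \<tau> * head_norm M p f1 \<tau> \<le> ennreal (1 / \<tau>) * ennreal (l * \<tau> powr (1 / p))"
      proof (intro mult_mono ennreal_leI divide_right_mono)
        have "ln \<tau> \<le> 0" using 2 s by simp
        then have "(1 - ln \<tau>) powr (- 1 / p) \<le> (1 - ln \<tau>) powr 0"
          using p by (intro powr_mono) auto
        then show "(1 - ln \<tau>) powr (- 1 / p) \<le> 1" using \<open>ln \<tau> \<le> 0\<close> by simp
      qed (use 2 in auto)
      also have "\<dots> = ennreal (l * \<tau> powr (1 / p - 1))"
        using 2 l by (simp add: powr_diff flip: ennreal_mult)
      finally show ?thesis using 2 s l by (simp add: ennreal_mult)
    next
      case 3
      have "head_norm M p f1 \<tau> \<le> head_norm M p f \<tau>"
        by (rule head_norm_mono_fun) (use l p in \<open>auto simp: f1_def\<close>)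
      then show ?thesis using 3 s by (simp add: mult_left_mono)
    qed auto
  qed
  also have "\<dots> = ?I + ennreal l * (\<integral>\<^sup>+\<tau>\<in>{0<..<s}. ennreal (\<tau> powr (1 / p - 1)) \<partial>lborel)"
    using p by (subst nn_integral_add, measurable)
      (simp add: nn_integral_cmult)
  also have "(\<integral>\<^sup>+\<tau>\<in>{0<..<s}. ennreal (\<tau> powr (1 / p - 1)) \<partial>lborel) = ennreal p * ennreal (s powr (1 / p))"
    using p s by (subst nn_integral_powr_from_0) (auto simp: mult.commute simp flip: ennreal_mult)
  also have "ennreal l * (ennreal p * ennreal (s powr (1 / p))) = ennreal p * ennreal (l * s powr (1 / p))"
    using l by (simp add: ennreal_mult ac_simps)
  also have "?I + \<dots> \<le> ?I + ennreal p * ?H"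
    unfolding l_def using p s by (intro add_left_mono mult_left_mono decr_rearr_times_powr_le_head_norm) auto
  finally have N1: "fnorm (small_Lebesgue M p 1) f1 \<le> ?I + ennreal p * ?H" .
  show ?thesis
  \<comment> \<open>when the right-hand side is finite, the bounds themselves show that both parts
    lie in their spaces\<close>
  proof (cases "?H + ennreal t * (?I + ennreal p * ?H) = \<infinity>")
    case False
    then have "?H < \<infinity>" "?I + ennreal p * ?H < \<infinity>"
      using t by (auto simp: ennreal_mult_eq_top_iff less_top[symmetric] ennreal_mult_less_top)
    then have "(f0, f1) \<in> decompositions M (Lp M p) (small_Lebesgue M p 1) f"
      using N0 N1 by (auto simp: decompositions_def carr_Lp carr_small_Lebesgue f0_def[symmetric] intro: le_less_trans)
         (simp_all add: f0_def)
    then have "K_functional M (Lp M p) (small_Lebesgue M p 1) f t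
        \<le> fnorm (Lp M p) f0 + ennreal t * fnorm (small_Lebesgue M p 1) f1"
      unfolding K_functional_def by (rule INF_lower2) simp
    also have "\<dots> \<le> ?H + ennreal t * (?I + ennreal p * ?H)"
      by (intro add_mono mult_left_mono N0 N1) auto
    finally show ?thesis .
  qed (simp only: infinity_ennreal_def top_greatest)
qed

section \<open>From the K-functional to the interpolation norm\<close>

text \<open>
  The change of variable identifies the norm of index \<open>\<theta>\<close> with the integral of a power weight in
  the variable of the K-functional. The exponent of \<open>1 - ln s\<close> is
  \<open>q * \<theta> + q - q - 1 = - \<theta> / p + \<theta> - 1\<close>: the summands come from the power
  \<open>t powr (- \<theta>)\<close>, the factor \<open>1 / t\<close> and the derivative of the substitution.
\<close>

lemma nn_integral_powr_head_norm_log_substitution: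
  fixes p \<theta> :: real
  assumes p: "1 < p"
  shows "(\<integral>\<^sup>+t\<in>{0<..<1}. ennreal (t powr (- \<theta>) / t) * head_norm M p f (exp (1 - t powr (- 1 / (1 - 1 / p)))) \<partial>lborel)
    = ennreal (1 - 1 / p) * fnorm (small_Lebesgue M p \<theta>) f"
proof -
  define q where "q = 1 - 1 / p"
  have q: "0 < q" using p by (simp add: q_def)
  have p0: "0 \<le> p" using p by simp
  note [measurable] = measurable_head_norm[OF p0, of M f]
  have "(\<integral>\<^sup>+t\<in>{0<..<1}. ennreal (t powr (- \<theta>) / t) * head_norm M p f (exp (1 - t powr (- 1 / q))) \<partial>lborel)
    = (\<integral>\<^sup>+s\<in>{0<..<1}. (ennreal (((1 - ln s) powr (- q)) powr (- \<theta>) / (1 - ln s) powr (- q))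
        * head_norm M p f (exp (1 - ((1 - ln s) powr (- q)) powr (- 1 / q))))
        * ennreal (q * (1 - ln s) powr (- q - 1) / s) \<partial>lborel)"
    using p by (intro nn_integral_log_substitution q) measurable
  also have "\<dots> = (\<integral>\<^sup>+s. ennreal q * (ennreal ((1 - ln s) powr (- \<theta> / p + \<theta> - 1) / s) * head_norm M p f s * indicator {0<..<1} s) \<partial>lborel)"
  proof (rule nn_integral_cong)
    fix s :: real
    show "(ennreal (((1 - ln s) powr (- q)) powr (- \<theta>) / (1 - ln s) powr (- q))
        * head_norm M p f (exp (1 - ((1 - ln s) powr (- q)) powr (- 1 / q))))
        * ennreal (q * (1 - ln s) powr (- q - 1) / s) * indicator {0<..<1} s
      = ennreal q * (ennreal ((1 - ln s) powr (- \<theta> / p + \<theta> - 1) / s) * head_norm M p f s * indicator {0<..<1} s)"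
    proof (cases "s \<in> {0<..<1}")
      case True
      define L where "L = 1 - ln s"
      have L: "1 \<le> L" using True by (simp add: L_def)
      have "(L powr (- q)) powr (- 1 / q) = L" using L q by (simp add: powr_powr)
      then have e: "exp (1 - (L powr (- q)) powr (- 1 / q)) = s" using True by (simp add: L_def)
      have "(L powr (- q)) powr (- \<theta>) / L powr (- q) * (q * L powr (- q - 1) / s)
          = q * ((L powr (q * \<theta>) / L powr (- q) * L powr (- q - 1)) / s)"
        by (simp add: powr_powr)
      also have "L powr (q * \<theta>) / L powr (- q) * L powr (- q - 1) = L powr (q * \<theta> - (- q) + (- q - 1))"
        by (simp only: powr_diff powr_add)
      also have "q * \<theta> - (- q) + (- q - 1) = - \<theta> / p + \<theta> - 1" by (simp add: q_def algebra_simps)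
      finally have w: "ennreal ((L powr (- q)) powr (- \<theta>) / L powr (- q)) * ennreal (q * L powr (- q - 1) / s)
          = ennreal q * ennreal (L powr (- \<theta> / p + \<theta> - 1) / s)"
        using True q by (simp flip: ennreal_mult)
      have "a * X * b = c * (d * X)" if "a * b = c * d" for a b c d X :: ennreal
        using that by (metis mult.assoc mult.commute)
      from this[OF w] show ?thesis using True e by (simp add: L_def)
    qed simp
  qed
  also have "\<dots> = ennreal q * fnorm (small_Lebesgue M p \<theta>) f"
    unfolding fnorm_small_Lebesgue using p by (intro nn_integral_cmult) measurable
  finally show ?thesis by (simp add: q_def)
qed

text \<open>
  Hardy's inequality in the logarithmic variable. After Fubini, the inner integral runs over
  those \<open>t\<close> whose point \<open>s\<close> lies below \<open>\<tau>\<close>, that is, over \<open>t < (1 - ln \<tau>) powr (- q)\<close>, and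
  \<open>t powr (- \<theta>)\<close> is integrable at 0 because \<open>\<theta> < 1\<close>. The factor \<open>t\<close> of the second norm in
  the K-functional has cancelled the \<open>1 / t\<close> of the interpolation norm.
\<close>

lemma nn_integral_log_Hardy:
  fixes p \<theta> :: real
  assumes p: "1 < p" and \<theta>: "\<theta> < 1"
  shows "(\<integral>\<^sup>+t\<in>{0<..<1}. ennreal (t powr (- \<theta>)) *
      (\<integral>\<^sup>+\<tau>\<in>{exp (1 - t powr (- 1 / (1 - 1 / p)))<..<1}.
         ennreal ((1 - ln \<tau>) powr (- 1 / p) / \<tau>) * head_norm M p f \<tau> \<partial>lborel) \<partial>lborel)
    \<le> ennreal (1 / (1 - \<theta>)) * fnorm (small_Lebesgue M p \<theta>) f"
proof -
  define q where "q = 1 - 1 / p"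
  have q: "0 < q" using p by (simp add: q_def)
  have p0: "0 \<le> p" using p by simp
  note [measurable] = measurable_head_norm[OF p0, of M f]
  let ?s = "\<lambda>t. exp (1 - t powr (- 1 / q))"
  let ?F = "\<lambda>\<tau>. ennreal ((1 - ln \<tau>) powr (- 1 / p) / \<tau>) * head_norm M p f \<tau>"
  let ?G = "\<lambda>t \<tau>. (ennreal (t powr (- \<theta>)) * (if 0 < t \<and> t < 1 then 1 else 0)) *
      (?F \<tau> * (if ?s t < \<tau> \<and> \<tau> < 1 then 1 else 0))"
  have Fm[measurable]: "?F \<in> borel_measurable borel" using p by measurable
  have "(\<integral>\<^sup>+t\<in>{0<..<1}. ennreal (t powr (- \<theta>)) * (\<integral>\<^sup>+\<tau>\<in>{?s t<..<1}. ?F \<tau> \<partial>lborel) \<partial>lborel)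
      = (\<integral>\<^sup>+t. (\<integral>\<^sup>+\<tau>. ?G t \<tau> \<partial>lborel) \<partial>lborel)"
  proof (rule nn_integral_cong)
    fix t :: real
    have "(\<integral>\<^sup>+\<tau>. ?G t \<tau> \<partial>lborel) = (ennreal (t powr (- \<theta>)) * (if 0 < t \<and> t < 1 then 1 else 0)) *
        (\<integral>\<^sup>+\<tau>. ?F \<tau> * (if ?s t < \<tau> \<and> \<tau> < 1 then 1 else 0) \<partial>lborel)"
      by (rule nn_integral_cmult) measurable
    also have "(\<integral>\<^sup>+\<tau>. ?F \<tau> * (if ?s t < \<tau> \<and> \<tau> < 1 then 1 else 0) \<partial>lborel) = (\<integral>\<^sup>+\<tau>\<in>{?s t<..<1}. ?F \<tau> \<partial>lborel)"
      by (rule nn_integral_cong) (simp add: indicator_def)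
    finally show "ennreal (t powr (- \<theta>)) * (\<integral>\<^sup>+\<tau>\<in>{?s t<..<1}. ?F \<tau> \<partial>lborel) * indicator {0<..<1} t
        = (\<integral>\<^sup>+\<tau>. ?G t \<tau> \<partial>lborel)"
      by (simp add: indicator_def)
  qed
  also have "\<dots> = (\<integral>\<^sup>+\<tau>. (\<integral>\<^sup>+t. ?G t \<tau> \<partial>lborel) \<partial>lborel)"
    by (rule lborel_pair.Fubini'[symmetric]) measurable
  also have "\<dots> \<le> (\<integral>\<^sup>+\<tau>. ennreal (1 / (1 - \<theta>)) *
      (ennreal ((1 - ln \<tau>) powr (- \<theta> / p + \<theta> - 1) / \<tau>) * head_norm M p f \<tau> * indicator {0<..<1} \<tau>) \<partial>lborel)"
  proof (rule nn_integral_mono)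
    fix \<tau> :: real
    show "(\<integral>\<^sup>+t. ?G t \<tau> \<partial>lborel) \<le> ennreal (1 / (1 - \<theta>)) *
      (ennreal ((1 - ln \<tau>) powr (- \<theta> / p + \<theta> - 1) / \<tau>) * head_norm M p f \<tau> * indicator {0<..<1} \<tau>)"
    proof (cases "\<tau> \<in> {0<..<1}")
      case True
      define L where "L = 1 - ln \<tau>"
      have L: "1 \<le> L" using True by (simp add: L_def)
      have range: "t < L powr (- q)" if "0 < t" "?s t < \<tau>" for t
      proof -
        have "1 - t powr (- 1 / q) < ln \<tau>" using that True by (metis exp_less_cancel_iff exp_ln greaterThanLessThan_iff)
        then have "L < t powr (- 1 / q)" by (simp add: L_def)
        then have "(t powr (- 1 / q)) powr (- q) < L powr (- q)"
          using L q by (intro powr_less_mono2_neg) auto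
        then show ?thesis using that q by (simp add: powr_powr)
      qed
      have "(\<integral>\<^sup>+t. ?G t \<tau> \<partial>lborel) \<le> (\<integral>\<^sup>+t. (ennreal (t powr (- \<theta>)) * indicator {0<..<L powr (- q)} t) * ?F \<tau> \<partial>lborel)"
        using range by (intro nn_integral_mono) auto
      also have "\<dots> = (\<integral>\<^sup>+t\<in>{0<..<L powr (- q)}. ennreal (t powr (- \<theta>)) \<partial>lborel) * ?F \<tau>"
        by (rule nn_integral_multc) measurable
      also have "(\<integral>\<^sup>+t\<in>{0<..<L powr (- q)}. ennreal (t powr (- \<theta>)) \<partial>lborel)
          = ennreal ((L powr (- q)) powr (- \<theta> + 1) / (- \<theta> + 1))"
        by (rule nn_integral_powr_from_0) (use \<theta> in auto)
      also have "\<dots> * ?F \<tau> = ennreal ((L powr (- q)) powr (- \<theta> + 1) / (- \<theta> + 1) * (L powr (- 1 / p) / \<tau>)) * head_norm M p f \<tau>"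
        using True \<theta> unfolding L_def[symmetric] by (subst ennreal_mult) (auto simp: mult.assoc)
      also have "(L powr (- q)) powr (- \<theta> + 1) / (- \<theta> + 1) * (L powr (- 1 / p) / \<tau>)
          = 1 / (1 - \<theta>) * ((L powr (- q * (- \<theta> + 1)) * L powr (- 1 / p)) / \<tau>)"
        by (simp add: powr_powr)
      also have "L powr (- q * (- \<theta> + 1)) * L powr (- 1 / p) = L powr (- q * (- \<theta> + 1) + - 1 / p)"
        by (simp only: powr_add)
      also have "- q * (- \<theta> + 1) + - 1 / p = - \<theta> / p + \<theta> - 1"
        using p by (simp add: q_def field_simps)
      also have "ennreal (1 / (1 - \<theta>) * (L powr (- \<theta> / p + \<theta> - 1) / \<tau>)) * head_norm M p f \<tau>
          = ennreal (1 / (1 - \<theta>)) * (ennreal (L powr (- \<theta> / p + \<theta> - 1) / \<tau>) * head_norm M p f \<tau>)"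
        using True \<theta> by (subst ennreal_mult) (auto simp: mult.assoc)
      finally show ?thesis using True by (simp add: L_def)
    next
      case False
      have "?G t \<tau> = 0" for t
      proof -
        have "\<not> (?s t < \<tau> \<and> \<tau> < 1)" using False exp_gt_zero[of "1 - t powr (- 1 / q)"]
          by (auto simp del: exp_gt_zero)
        then have "(if ?s t < \<tau> \<and> \<tau> < 1 then 1 else 0 :: ennreal) = 0" by (rule if_not_P)
        then show ?thesis by (simp only: mult_zero_right)
      qed
      then have "(\<integral>\<^sup>+t. ?G t \<tau> \<partial>lborel) = 0" by (simp only: nn_integral_const mult_zero_left)
      then show ?thesis by (simp only: zero_le)
    qed
  qed
  also have "\<dots> = ennreal (1 / (1 - \<theta>)) * fnorm (small_Lebesgue M p \<theta>) f"
    unfolding fnorm_small_Lebesgue using p by (intro nn_integral_cmult) measurable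
  finally show ?thesis by (simp add: q_def)
qed

lemma log_change_of_variable:
  assumes "0 < q" "0 < t" "t < (1::real)"
  shows "exp (1 - t powr (- 1 / q)) \<in> {0<..<1}"
    and "(1 - ln (exp (1 - t powr (- 1 / q)))) powr (- q) = t"
proof -
  have "1 powr (- 1 / q) < t powr (- 1 / q)"
    using assms by (intro powr_less_mono2_neg) auto
  then show "exp (1 - t powr (- 1 / q)) \<in> {0<..<1}" by simp
  show "(1 - ln (exp (1 - t powr (- 1 / q)))) powr (- q) = t"
    using assms by (simp add: powr_powr)
qed

text \<open>
  The bound \<open>K_functional_le\<close> is used at the point \<open>s\<close> that corresponds to \<open>t\<close>. As \<open>t < 1\<close>, its
  last term \<open>t * p * F(s)\<close> joins the first one.
\<close>

lemma (in prob_space) interp_norm_le_small_Lebesgue: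
  fixes p \<theta> :: real
  assumes f: "f \<in> borel_measurable M" and p: "1 < p" and \<theta>: "\<theta> < 1"
  shows "interp_norm M (Lp M p) (small_Lebesgue M p 1) \<theta> f
    \<le> ennreal ((1 + p) * (1 - 1 / p) + 1 / (1 - \<theta>)) * fnorm (small_Lebesgue M p \<theta>) f"
proof -
  define q where "q = 1 - 1 / p"
  have q: "0 < q" using p by (simp add: q_def)
  let ?s = "\<lambda>t. exp (1 - t powr (- 1 / q))" and ?N = "fnorm (small_Lebesgue M p \<theta>) f"
  let ?I = "\<lambda>t. \<integral>\<^sup>+\<tau>\<in>{?s t<..<1}. ennreal ((1 - ln \<tau>) powr (- 1 / p) / \<tau>) * head_norm M p f \<tau> \<partial>lborel"
  let ?H = "\<lambda>t. head_norm M p f (?s t)"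
  have p0: "0 \<le> p" using p by simp
  note [measurable] = measurable_head_norm[OF p0, of M f]
  have Im: "?I \<in> borel_measurable borel"
  proof -
    have "(\<lambda>t. \<integral>\<^sup>+\<tau>. ennreal ((1 - ln \<tau>) powr (- 1 / p) / \<tau>) * head_norm M p f \<tau> *
        (if ?s t < \<tau> \<and> \<tau> < 1 then 1 else 0) \<partial>lborel) \<in> borel_measurable lborel"
      by measurable
    then show ?thesis by (simp add: indicator_def)
  qed
  have "interp_norm M (Lp M p) (small_Lebesgue M p 1) \<theta> f \<le> (\<integral>\<^sup>+t.
      ennreal (1 + p) * (ennreal (t powr (- \<theta>) / t) * ?H t * indicator {0<..<1} t)
      + ennreal (t powr (- \<theta>)) * ?I t * indicator {0<..<1} t \<partial>lborel)"
    unfolding interp_norm_def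
  proof (rule nn_integral_mono)
    fix t :: real
    show "ennreal (t powr (- \<theta>) / t) * K_functional M (Lp M p) (small_Lebesgue M p 1) f t * indicator {0<..<1} t
      \<le> ennreal (1 + p) * (ennreal (t powr (- \<theta>) / t) * ?H t * indicator {0<..<1} t)
      + ennreal (t powr (- \<theta>)) * ?I t * indicator {0<..<1} t"
    proof (cases "t \<in> {0<..<1}")
      case True
      then have s: "0 < ?s t" "?s t < 1" using log_change_of_variable(1)[OF q, of t] by auto
      have "K_functional M (Lp M p) (small_Lebesgue M p 1) f t \<le> ?H t + ennreal t * (?I t + ennreal p * ?H t)"
        using True by (intro K_functional_le f p s) auto
      also have "\<dots> = ?H t + ennreal t * (ennreal p * ?H t) + ennreal t * ?I t"
        by (simp add: distrib_left ac_simps)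
      also have "\<dots> \<le> ?H t + ennreal 1 * (ennreal p * ?H t) + ennreal t * ?I t"
        using True by (intro add_mono mult_right_mono ennreal_leI) auto
      also have "\<dots> = ennreal (1 + p) * ?H t + ennreal t * ?I t"
        using p by (simp add: distrib_right)
      finally have "ennreal (t powr (- \<theta>) / t) * K_functional M (Lp M p) (small_Lebesgue M p 1) f t
        \<le> ennreal (t powr (- \<theta>) / t) * (ennreal (1 + p) * ?H t + ennreal t * ?I t)"
        by (intro mult_left_mono) auto
      also have "\<dots> = ennreal (1 + p) * (ennreal (t powr (- \<theta>) / t) * ?H t) + ennreal (t powr (- \<theta>) / t) * ennreal t * ?I t"
        by (simp only: distrib_left ac_simps)
      also have "ennreal (t powr (- \<theta>) / t) * ennreal t = ennreal (t powr (- \<theta>))"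
        using True by (simp flip: ennreal_mult)
      finally show ?thesis using True by simp
    qed simp
  qed
  also have "\<dots> = ennreal (1 + p) * (\<integral>\<^sup>+t\<in>{0<..<1}. ennreal (t powr (- \<theta>) / t) * ?H t \<partial>lborel)
      + (\<integral>\<^sup>+t\<in>{0<..<1}. ennreal (t powr (- \<theta>)) * ?I t \<partial>lborel)"
    using p Im by (subst nn_integral_add) (auto simp: nn_integral_cmult)
  also have "\<dots> \<le> ennreal (1 + p) * (ennreal q * ?N) + ennreal (1 / (1 - \<theta>)) * ?N"
    using nn_integral_log_Hardy[OF p \<theta>, of M f] nn_integral_powr_head_norm_log_substitution[OF p, of \<theta> M f]
    unfolding q_def by (intro add_mono) auto
  also have "\<dots> = ennreal ((1 + p) * q + 1 / (1 - \<theta>)) * ?N"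
    using p q \<theta> by (simp add: ennreal_mult distrib_right mult.assoc)
  finally show ?thesis by (simp add: q_def)
qed

text \<open>
  Constants are moved to the side of \<open>F\<close>, which is measurable in \<open>t\<close>, and the K-functional is only
  compared pointwise: its integral is not manipulated beyond monotonicity.
\<close>

lemma (in prob_space) small_Lebesgue_le_interp_norm:
  fixes p :: real
  assumes p: "1 < p"
  shows "\<exists>c>0. \<forall>f\<in>borel_measurable M. fnorm (small_Lebesgue M p \<theta>) f
    \<le> ennreal c * interp_norm M (Lp M p) (small_Lebesgue M p 1) \<theta> f"
proof -
  define q where "q = 1 - 1 / p"
  have q: "0 < q" using p by (simp add: q_def)
  have p0: "0 \<le> p" using p by simp
  let ?K = "K_functional M (Lp M p) (small_Lebesgue M p 1)"
  obtain c where c: "0 < c" "\<And>f s. f \<in> borel_measurable M \<Longrightarrow> s \<in> {0<..<1} \<Longrightarrow>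
      head_norm M p f s \<le> ennreal c * ?K f ((1 - ln s) powr (- q))"
    using head_norm_le_K_functional[OF p] unfolding q_def by blast
  have cancel: "ennreal (1 / a) * (ennreal a * x) = x" if "0 < a" for a x
  proof -
    have "ennreal (1 / a) * ennreal a = 1" using that by (simp flip: ennreal_mult)
    then show ?thesis by (simp flip: mult.assoc)
  qed
  have bound: "fnorm (small_Lebesgue M p \<theta>) f
      \<le> ennreal (1 / (q / c)) * interp_norm M (Lp M p) (small_Lebesgue M p 1) \<theta> f"
    if f: "f \<in> borel_measurable M" for f
  proof -
    note [measurable] = measurable_head_norm[OF p0, of M f]
    let ?H = "\<lambda>t. head_norm M p f (exp (1 - t powr (- 1 / q)))"
    let ?i = "interp_norm M (Lp M p) (small_Lebesgue M p 1) \<theta> f"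
    have "ennreal (1 / c) * (ennreal q * fnorm (small_Lebesgue M p \<theta>) f)
        = ennreal (1 / c) * (\<integral>\<^sup>+t\<in>{0<..<1}. ennreal (t powr (- \<theta>) / t) * ?H t \<partial>lborel)"
      using nn_integral_powr_head_norm_log_substitution[OF p, of \<theta> M f] by (simp add: q_def)
    also have "\<dots> = (\<integral>\<^sup>+t. ennreal (1 / c) * (ennreal (t powr (- \<theta>) / t) * ?H t * indicator {0<..<1} t) \<partial>lborel)"
      by (rule nn_integral_cmult[symmetric]) measurable
    also have "\<dots> \<le> ?i"
      unfolding interp_norm_def
    proof (rule nn_integral_mono)
      fix t :: real
      show "ennreal (1 / c) * (ennreal (t powr (- \<theta>) / t) * ?H t * indicator {0<..<1} t)
        \<le> ennreal (t powr (- \<theta>) / t) * ?K f t * indicator {0<..<1} t"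
      proof (cases "t \<in> {0<..<1}")
        case True
        then have "?H t \<le> ennreal c * ?K f t"
          using c(2)[OF f log_change_of_variable(1)[OF q, of t]] log_change_of_variable(2)[OF q, of t] by simp
        then have "ennreal (1 / c) * ?H t \<le> ?K f t"
          using cancel[OF c(1), of "?K f t"] by (metis mult_left_mono zero_le)
        then have "ennreal (t powr (- \<theta>) / t) * (ennreal (1 / c) * ?H t) \<le> ennreal (t powr (- \<theta>) / t) * ?K f t"
          by (intro mult_left_mono) auto
        then show ?thesis using True by (simp add: mult.left_commute)
      qed simp
    qed
    finally have *: "ennreal (1 / c) * (ennreal q * fnorm (small_Lebesgue M p \<theta>) f) \<le> ?i" .
    have "fnorm (small_Lebesgue M p \<theta>) f
        = ennreal (1 / (q / c)) * (ennreal (q / c) * fnorm (small_Lebesgue M p \<theta>) f)"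
      using c q by (intro cancel[symmetric]) simp
    also have "ennreal (q / c) = ennreal (1 / c) * ennreal q" using c q by (simp flip: ennreal_mult)
    also have "ennreal (1 / (q / c)) * (\<dots> * fnorm (small_Lebesgue M p \<theta>) f) \<le> ennreal (1 / (q / c)) * ?i"
      using * by (intro mult_left_mono) (simp_all add: mult.assoc)
    finally show ?thesis .
  qed
  then show ?thesis using c q by (intro exI[of _ "1 / (q / c)"]) simp
qed

text \<open>
  The infimum over an empty set of decompositions is \<open>\<infinity>\<close>. Hence a finite interpolation norm already
  forces membership in the sum of the two spaces.
\<close>

lemma interp_norm_top_if_no_decomposition:
  assumes "decompositions M X0 X1 f = {}"
  shows "interp_norm M X0 X1 \<theta> f = \<infinity>"
proof -
  have "\<infinity> = (\<integral>\<^sup>+t\<in>{0<..<1::real}. \<infinity> \<partial>lborel)"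
    by (subst nn_integral_cmult_indicator) (auto simp: ennreal_top_mult)
  also have "\<dots> \<le> interp_norm M X0 X1 \<theta> f"
    unfolding interp_norm_def
  proof (rule nn_integral_mono)
    fix t :: real
    have "K_functional M X0 X1 f t = \<infinity>" by (simp add: K_functional_def assms)
    then show "\<infinity> * indicator {0<..<1} t \<le> ennreal (t powr (- \<theta>) / t) * K_functional M X0 X1 f t * indicator {0<..<1} t"
      by (cases "t \<in> {0<..<1}") (auto simp: ennreal_mult_top)
  qed
  finally show ?thesis by (simp add: top_unique)
qed

theorem (in prob_space) interpolation_Lp_small_Lebesgue:
  fixes p \<theta> :: real
  assumes p: "1 < p" and \<theta>: "\<theta> < 1"
  shows "equal_equiv_norms (interp_space_1 M (Lp M p) (small_Lebesgue M p 1) \<theta>) (small_Lebesgue M p \<theta>)"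
proof -
  let ?X = "interp_space_1 M (Lp M p) (small_Lebesgue M p 1) \<theta>" and ?Y = "small_Lebesgue M p \<theta>"
  let ?i = "interp_norm M (Lp M p) (small_Lebesgue M p 1) \<theta>"
  define D where "D = (1 + p) * (1 - 1 / p) + 1 / (1 - \<theta>)"
  have D: "0 < D" unfolding D_def using p \<theta> by (intro add_pos_pos mult_pos_pos) auto
  have X: "carr ?X = {f \<in> sum_carr M (Lp M p) (small_Lebesgue M p 1). ?i f < \<infinity>}" "fnorm ?X = ?i"
    by (simp_all add: carr_def fnorm_def interp_space_1_def)
  have upper: "?i f \<le> ennreal D * fnorm ?Y f" if "f \<in> borel_measurable M" for f
    unfolding D_def by (rule interp_norm_le_small_Lebesgue[OF that p \<theta>])
  obtain c where c: "0 < c" "\<And>f. f \<in> borel_measurable M \<Longrightarrow> fnorm ?Y f \<le> ennreal c * ?i f"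
    using small_Lebesgue_le_interp_norm[OF p, of \<theta>] by blast
  have carr: "carr ?X = carr ?Y"
  proof (intro set_eqI iffI)
    fix f assume "f \<in> carr ?X"
    then have f: "f \<in> borel_measurable M" "?i f < \<infinity>" by (auto simp: X sum_carr_def)
    then have "fnorm ?Y f < \<infinity>"
      by (intro le_less_trans[OF c(2)]) (auto simp: ennreal_mult_less_top)
    then show "f \<in> carr ?Y" using f by (simp add: carr_small_Lebesgue)
  next
    fix f assume "f \<in> carr ?Y"
    then have f: "f \<in> borel_measurable M" "fnorm ?Y f < \<infinity>" by (auto simp: carr_small_Lebesgue)
    then have "?i f < \<infinity>"
      by (intro le_less_trans[OF upper]) (auto simp: ennreal_mult_less_top)
    moreover from this have "decompositions M (Lp M p) (small_Lebesgue M p 1) f \<noteq> {}"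
      using interp_norm_top_if_no_decomposition[of M "Lp M p" "small_Lebesgue M p 1" f \<theta>] by auto
    ultimately show "f \<in> carr ?X" using f by (simp add: X sum_carr_def)
  qed
  have lower: "ennreal (1 / D) * ?i f \<le> fnorm ?Y f" if "f \<in> borel_measurable M" for f
  proof -
    have "ennreal (1 / D) * ?i f \<le> ennreal (1 / D) * (ennreal D * fnorm ?Y f)"
      by (intro mult_left_mono upper that) simp
    also have "\<dots> = (ennreal (1 / D) * ennreal D) * fnorm ?Y f" by (simp only: mult.assoc)
    also have "ennreal (1 / D) * ennreal D = 1" using D by (simp flip: ennreal_mult)
    finally show ?thesis by simp
  qed
  have "\<forall>f\<in>carr ?X. ennreal (1 / D) * fnorm ?X f \<le> fnorm ?Y f \<and> fnorm ?Y f \<le> ennreal c * fnorm ?X f"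
    using lower c(2) by (simp add: X sum_carr_def)
  moreover have "0 < 1 / D" using D by simp
  ultimately show ?thesis
    unfolding equal_equiv_norms_def using carr c(1) by blast
qed

theorem corollary1p8:
  fixes \<Omega> :: "(real ^ 'n) set" and n' \<theta> :: real
  assumes "CARD('n) \<ge> 2"
    and "n' = real CARD('n) / (real CARD('n) - 1)"
    and "open \<Omega>" and "bounded \<Omega>" and "emeasure lebesgue \<Omega> = 1"
    and "0 < \<theta>" and "\<theta> < 1"
  shows "equal_equiv_norms
    (interp_space_1 (lebesgue_on \<Omega>) (Lp (lebesgue_on \<Omega>) n') (small_Lebesgue (lebesgue_on \<Omega>) n' 1) \<theta>)
    (small_Lebesgue (lebesgue_on \<Omega>) n' \<theta>)"
proof -
  have "emeasure (lebesgue_on \<Omega>) (space (lebesgue_on \<Omega>)) = 1"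
    using assms(3,5) by (simp add: space_restrict_space emeasure_restrict_space)
  then interpret prob_space "lebesgue_on \<Omega>" by (rule prob_spaceI)
  have "2 \<le> real CARD('n)" using assms(1) by simp
  then have "1 < n'" unfolding assms(2) by (subst less_divide_eq_1_pos) auto
  then show ?thesis using assms(7) by (rule interpolation_Lp_small_Lebesgue)
qed

end
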